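(* Let $m\geq 92$ be an even integer and let $G$ be a simple graph with exactly $m$ edges and no isolated vertices which does not contain $\theta(1,3,3)$ as a subgraph. Then $\rho(G)\leq \rho\big(S_{\frac{m+4}{2},2}^{-}\big)$, and equality holds if and only if $G\cong S_{\frac{m+4}{2},2}^{-}$.
   Context: All graphs are finite, simple and undirected. $\rho(G)$ denotes the spectral radius (largest eigenvalue of the adjacency matrix) of $G$. The theta graph $\theta(1,p,q)$ is the graph obtained by connecting two distinct vertices by three internally disjoint paths of lengths $1$, $p$ and $q$; thus $\theta(1,3,3)$ consists of an edge $xy$ together with two further internally disjoint $x$–$y$ paths each of length $3$. A graph contains $F$ if it has a (not necessarily induced) subgraph isomorphic to $F$. For $n>k$, $S_{n,k}$ denotes the graph $K_k\vee (n-k)K_1$ obtained by joining every vertex of a complete graph $K_k$ to each of $n-k$ isolated vertices, and $S_{n,k}^{-}$ denotes the graph obtained from $S_{n,k}$ by deleting one edge incident to a vertex of degree $k$ (i.e. an edge between a vertex of the $K_k$ and one of the $n-k$ independent vertices). In particular $S_{\frac{m+4}{2},2}^{-}$ has exactly $m$ edges. *)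

theory Defs
  imports "Jordan_Normal_Form.Char_Poly"
begin

text \<open>A simple undirected graph is a vertex set together with a set of two-element sets of
  vertices. The record itself carries no invariant; well-formedness and finiteness are
  stated by \<open>fin_simple_graph\<close>.\<close>

record 'a sgraph =
  vertices :: "'a set"
  edges :: "'a set set"

definition fin_simple_graph :: "'a sgraph \<Rightarrow> bool" where
  "fin_simple_graph G \<longleftrightarrow>
     finite (vertices G) \<and> (\<forall>e\<in>edges G. e \<subseteq> vertices G \<and> card e = 2)"

definition no_isolated_vertices :: "'a sgraph \<Rightarrow> bool" where
  "no_isolated_vertices G \<longleftrightarrow> (\<forall>v\<in>vertices G. \<exists>u\<in>vertices G. {u, v} \<in> edges G)"

definition graph_isomorphic :: "'a sgraph \<Rightarrow> 'b sgraph \<Rightarrow> bool" where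
  "graph_isomorphic G H \<longleftrightarrow>
     (\<exists>f. bij_betw f (vertices G) (vertices H) \<and>
          (\<forall>u\<in>vertices G. \<forall>v\<in>vertices G. {u, v} \<in> edges G \<longleftrightarrow> {f u, f v} \<in> edges H))"

definition subgraph_of :: "'a sgraph \<Rightarrow> 'a sgraph \<Rightarrow> bool" where
  "subgraph_of H G \<longleftrightarrow>
     fin_simple_graph H \<and> vertices H \<subseteq> vertices G \<and> edges H \<subseteq> edges G"

definition contains_graph :: "'a sgraph \<Rightarrow> 'b sgraph \<Rightarrow> bool" where
  "contains_graph G F \<longleftrightarrow> (\<exists>H. subgraph_of H G \<and> graph_isomorphic H F)"

definition adjacency_matrix :: "'a list \<Rightarrow> 'a sgraph \<Rightarrow> real mat" where
  "adjacency_matrix vs G =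
     mat (length vs) (length vs) (\<lambda>(i, j). if {vs ! i, vs ! j} \<in> edges G then 1 else 0)"

text \<open>The rows and columns are ordered by an arbitrarily chosen enumeration of the vertices.
  The eigenvalues do not depend on it: see \<open>eigenvalue_adjacency_matrix_iff\<close>.
  The value is meaningful only for a finite graph with at least one vertex.\<close>

definition graph_spectral_radius :: "'a sgraph \<Rightarrow> real" where
  "graph_spectral_radius G =
     Max {k. eigenvalue
               (adjacency_matrix (SOME vs. distinct vs \<and> set vs = vertices G) G) k}"

definition path_edges :: "'a list \<Rightarrow> 'a set set" where
  "path_edges vs = {{vs ! i, vs ! Suc i} |i. Suc i < length vs}"

text \<open>\<open>theta1 p q\<close> is the graph \<open>\<theta>(1,p,q)\<close>. The two branch vertices are \<open>0\<close> and \<open>p\<close>; the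
  three paths are \<open>0, p\<close>, then \<open>0, 1, \<dots>, p\<close> and \<open>0, p+q-1, p+q-2, \<dots>, p\<close>, of lengths \<open>1\<close>, \<open>p\<close>
  and \<open>q\<close>. Intended for \<open>p, q \<ge> 2\<close>.\<close>

definition theta1 :: "nat \<Rightarrow> nat \<Rightarrow> nat sgraph" where
  "theta1 p q =
     \<lparr>vertices = {..<p + q},
      edges = path_edges [0, p] \<union> path_edges [0..<Suc p] \<union> path_edges (0 # rev [p..<p + q])\<rparr>"

definition complete_sgraph :: "nat \<Rightarrow> nat sgraph" where
  "complete_sgraph n = \<lparr>vertices = {..<n}, edges = {{i, j} |i j. i < n \<and> j < n \<and> i \<noteq> j}\<rparr>"

definition edgeless_sgraph :: "nat \<Rightarrow> nat sgraph" where
  "edgeless_sgraph n = \<lparr>vertices = {..<n}, edges = {}\<rparr>"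

definition graph_join :: "'a sgraph \<Rightarrow> 'b sgraph \<Rightarrow> ('a + 'b) sgraph" where
  "graph_join G H =
     \<lparr>vertices = vertices G <+> vertices H,
      edges = (\<lambda>e. Inl ` e) ` edges G \<union> (\<lambda>e. Inr ` e) ` edges H \<union>
              {{Inl u, Inr v} |u v. u \<in> vertices G \<and> v \<in> vertices H}\<rparr>"

definition S_graph :: "nat \<Rightarrow> nat \<Rightarrow> (nat + nat) sgraph" where
  "S_graph n k = graph_join (complete_sgraph k) (edgeless_sgraph (n - k))"

text \<open>For \<open>1 \<le> k < n\<close> the automorphisms of \<open>S_graph n k\<close> act transitively on the edges
  between the two parts, so deleting this particular one is no loss of generality.\<close>

definition S_minus_graph :: "nat \<Rightarrow> nat \<Rightarrow> (nat + nat) sgraph" where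
  "S_minus_graph n k = (S_graph n k)\<lparr>edges := edges (S_graph n k) - {{Inl 0, Inr 0}}\<rparr>"

lemma eigenvalue_adjacency_matrix_iff:
  assumes "distinct vs" and "set vs = vertices G"
  shows "eigenvalue (adjacency_matrix vs G) k \<longleftrightarrow>
    (\<exists>x. (\<exists>v\<in>vertices G. x v \<noteq> 0) \<and>
         (\<forall>v\<in>vertices G. (\<Sum>u | u \<in> vertices G \<and> {v, u} \<in> edges G. x u) = k * x v))"
    (is "_ \<longleftrightarrow> (\<exists>x. ?nz x \<and> ?eq x)")
proof -
  let ?n = "length vs" and ?A = "adjacency_matrix vs G"
  have dim: "dim_row ?A = ?n" by (simp add: adjacency_matrix_def)
  have fin: "finite (vertices G)" unfolding assms(2)[symmetric] by simp
  have bij: "bij_betw ((!) vs) {0..<?n} (vertices G)"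
    using bij_betw_nth[OF assms(1)] assms(2) by (simp add: atLeast0LessThan)
  have all_conv: "(\<forall>v\<in>vertices G. P v) \<longleftrightarrow> (\<forall>i<?n. P (vs ! i))" for P
    unfolding assms(2)[symmetric] by (rule all_set_conv_all_nth)
  have row: "(?A *\<^sub>v vec ?n (\<lambda>i. x (vs ! i))) $ i
      = (\<Sum>u | u \<in> vertices G \<and> {vs ! i, u} \<in> edges G. x u)" if "i < ?n" for x i
  proof -
    have "(?A *\<^sub>v vec ?n (\<lambda>i. x (vs ! i))) $ i
        = (\<Sum>j\<in>{0..<?n}. if {vs ! i, vs ! j} \<in> edges G then x (vs ! j) else 0)"
      using that by (auto simp: adjacency_matrix_def scalar_prod_def intro!: sum.cong)
    also have "\<dots> = (\<Sum>u\<in>vertices G. if {vs ! i, u} \<in> edges G then x u else 0)"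
      by (rule sum.reindex_bij_betw[OF bij,
            of "\<lambda>u. if {vs ! i, u} \<in> edges G then x u else 0"])
    also have "\<dots> = (\<Sum>u | u \<in> vertices G \<and> {vs ! i, u} \<in> edges G. x u)"
      using fin by (simp add: sum.inter_filter)
    finally show ?thesis .
  qed
  have ev: "eigenvector ?A (vec ?n (\<lambda>i. x (vs ! i))) k \<longleftrightarrow> ?nz x \<and> ?eq x" for x
  proof -
    have "vec ?n (\<lambda>i. x (vs ! i)) = 0\<^sub>v ?n \<longleftrightarrow> (\<forall>v\<in>vertices G. x v = 0)"
      unfolding all_conv by (simp add: vec_eq_iff)
    moreover have "?A *\<^sub>v vec ?n (\<lambda>i. x (vs ! i)) = k \<cdot>\<^sub>v vec ?n (\<lambda>i. x (vs ! i)) \<longleftrightarrow>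
        (\<forall>i<?n. (?A *\<^sub>v vec ?n (\<lambda>i. x (vs ! i))) $ i = k * x (vs ! i))"
      by (simp add: vec_eq_iff dim del: index_mult_mat_vec)
    moreover have "\<dots> \<longleftrightarrow> ?eq x"
      unfolding all_conv by (intro all_cong1 imp_cong refl) (simp only: row)
    ultimately show ?thesis
      unfolding eigenvector_def dim using vec_carrier by blast
  qed
  have vec_conv: "\<exists>x. y = vec ?n (\<lambda>i. x (vs ! i))" if y: "eigenvector ?A y k" for y
  proof -
    define x where "x = (\<lambda>v. y $ the_inv_into {0..<?n} ((!) vs) v)"
    have "x (vs ! i) = y $ i" if "i < ?n" for i
      using that bij by (simp add: x_def bij_betw_def the_inv_into_f_f)
    moreover have "dim_vec y = ?n"
      using y unfolding eigenvector_def dim by (simp only: carrier_vecD)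
    ultimately have "y = vec ?n (\<lambda>i. x (vs ! i))"
      by (intro eq_vecI) simp_all
    then show ?thesis by (rule exI[of _ x])
  qed
  have "eigenvalue ?A k \<longleftrightarrow> (\<exists>x. eigenvector ?A (vec ?n (\<lambda>i. x (vs ! i))) k)"
    unfolding eigenvalue_def using vec_conv by blast
  then show ?thesis by (simp add: ev)
qed

end

theory Submission
  imports "HOL-Analysis.Function_Topology" "Jordan_Normal_Form.Spectral_Radius" Defs
begin

text \<open>
  The graph \<open>\<theta>(1,3,3)\<close> is the domino, two 4-cycles sharing an edge. Let \<open>\<rho>\<close> be the spectral radius
  of \<open>G\<close> and suppose that it is at least that of \<open>S\<^sup>-\<close>; then \<open>\<rho>\<^sup>2 - \<rho> > m - 3/2\<close> and \<open>\<rho> > 10\<close>. Take a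
  nonnegative eigenvector with maximal entry \<open>x u = 1\<close>, put \<open>N = N(u)\<close> and let \<open>W\<close> be the remaining
  vertices. Expanding \<open>\<rho>\<^sup>2 x u\<close> gives
  \<open>\<Sum>\<^sub>W (d\<^sub>N(w) (1 - x w) + d\<^sub>W(w)/2) < 3/2 + \<Sum>\<^sub>N ((d\<^sub>N(v) - 1) x v - d\<^sub>N(v)/2)\<close>.
  As \<open>G[N]\<close> has no path on five vertices, its components are stars, graphs with all degrees at most
  4, stars plus an edge, or double stars. A component that is not a star contributes at most
  \<open>-3/2\<close> to the right side once its edges to \<open>W\<close> are charged to the left side, and a star with an
  edge contributes at most \<open>-1\<close>. So \<open>G[N]\<close> is one star plus isolated vertices, and the
  remaining slack \<open>1/2\<close> forces \<open>W = {}\<close>. The quartic equation for \<open>\<rho>\<close> then shows that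
  there is exactly one isolated vertex, that is \<open>G \<cong> S\<^sup>-\<close>.
\<close>

section \<open>Local structure around a vertex of maximal Perron weight\<close>

text \<open>The six vertices form a grid with rows \<open>a b c\<close> and \<open>d e f\<close>;
  the middle rung \<open>b e\<close> is the edge shared by the two 4-cycles. Instantiations of
  \<open>domino_free\<close> below list the grid in this order.\<close>

locale domino_free_graph =
  fixes V :: "'a set" and adj :: "'a \<Rightarrow> 'a \<Rightarrow> bool"
  assumes finV: "finite V"
    and adj_V: "adj v w \<Longrightarrow> v \<in> V"
    and adj_sym: "adj v w \<Longrightarrow> adj w v"
    and adj_irrefl: "\<not> adj v v"
    and domino_free: "\<lbrakk>distinct [a, b, c, d, e, f]; adj a b; adj b c; adj d e; adj e f;
          adj a d; adj b e; adj c f\<rbrakk> \<Longrightarrow> False"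
begin

section \<open>Neighbourhoods and degrees relative to a vertex set\<close>

definition nbr :: "'a set \<Rightarrow> 'a \<Rightarrow> 'a set" where
  "nbr A v = {w \<in> A. adj v w}"

definition deg :: "'a set \<Rightarrow> 'a \<Rightarrow> real" where
  "deg A v = real (card (nbr A v))"

lemma nbr_iff [simp]: "w \<in> nbr A v \<longleftrightarrow> w \<in> A \<and> adj v w"
  by (simp add: nbr_def)

lemma finite_nbr [simp]: "finite A \<Longrightarrow> finite (nbr A v)"
  by (simp add: nbr_def)

lemma deg_nonneg: "0 \<le> deg A v"
  by (simp add: deg_def)

lemma deg_eq_0_iff: "finite A \<Longrightarrow> deg A v = 0 \<longleftrightarrow> (\<forall>w\<in>A. \<not> adj v w)"
  by (auto simp: deg_def nbr_def)

lemma adj_V': "adj v w \<Longrightarrow> w \<in> V"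
  using adj_V adj_sym by blast

lemma adj_commute: "adj v w \<longleftrightarrow> adj w v"
  using adj_sym by blast

lemma sum_nbr_swap:
  assumes "finite A" "finite B"
  shows "(\<Sum>a\<in>A. sum f (nbr B a)) = (\<Sum>b\<in>B. deg A b * f b)"
proof -
  have "(\<Sum>a\<in>A. sum f (nbr B a)) = (\<Sum>a\<in>A. \<Sum>b\<in>B. if adj a b then f b else 0)"
    unfolding nbr_def using assms by (simp add: sum.inter_filter)
  also have "\<dots> = (\<Sum>b\<in>B. \<Sum>a\<in>A. if adj a b then f b else 0)"
    by (rule sum.swap)
  also have "\<dots> = (\<Sum>b\<in>B. \<Sum>a\<in>nbr A b. f b)"
  proof (rule sum.cong[OF refl])
    fix b
    show "(\<Sum>a\<in>A. if adj a b then f b else 0) = (\<Sum>a\<in>nbr A b. f b)"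
      unfolding nbr_def by (subst sum.inter_filter[OF assms(1)]) (simp only: adj_commute[of b])
  qed
  finally show ?thesis by (simp add: deg_def)
qed

lemma sum_nbr_deg_le:
  assumes "finite A" "\<And>w. w \<in> A \<Longrightarrow> f w \<le> 1"
  shows "sum f (nbr A v) \<le> deg A v"
  using sum_mono[of "nbr A v" f "\<lambda>_. 1"] assms by (simp add: deg_def)

end

text \<open>By the handshake lemma \<open>few_edges\<close> says \<open>m - 3/2 < \<rho>\<^sup>2 - \<rho>\<close>.\<close>

locale perron_domino_free = domino_free_graph V adj
  for V :: "'a set" and adj :: "'a \<Rightarrow> 'a \<Rightarrow> bool" +
  fixes x :: "'a \<Rightarrow> real" and \<rho> :: real and u :: 'a
  assumes u_in: "u \<in> V" and x_u: "x u = 1"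
    and x_nonneg: "v \<in> V \<Longrightarrow> 0 \<le> x v" and x_le_1: "v \<in> V \<Longrightarrow> x v \<le> 1"
    and eigen: "v \<in> V \<Longrightarrow> \<rho> * x v = sum x (nbr V v)"
    and rho_ge: "10 \<le> \<rho>"
    and few_edges: "(\<Sum>v\<in>V. deg V v) < 2 * (\<rho>\<^sup>2 - \<rho>) + 3"
begin

section \<open>The partition of \<open>V\<close> into \<open>u\<close>, its neighbourhood and the
  remaining vertices\<close>

definition N :: "'a set" where "N = nbr V u"

definition W :: "'a set" where "W = V - N - {u}"

lemma finN [simp]: "finite N" and finW [simp]: "finite W"
  using finV by (auto simp: N_def W_def)

lemma N_V: "v \<in> N \<Longrightarrow> v \<in> V" and W_V: "v \<in> W \<Longrightarrow> v \<in> V"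
  by (auto simp: N_def W_def)

lemma N_iff: "v \<in> N \<longleftrightarrow> adj u v"
  using adj_V' by (auto simp: N_def)

lemma N_not_W: "v \<in> N \<Longrightarrow> v \<notin> W" and u_notin [simp]: "u \<notin> N" "u \<notin> W"
  by (auto simp: W_def N_iff adj_irrefl)

lemma V_split: "V = insert u (N \<union> W)"
  using u_in N_V by (auto simp: W_def)

lemma N_adj_u: "v \<in> N \<Longrightarrow> adj v u"
  using N_iff adj_sym by blast

lemma W_not_adj_u: "v \<in> W \<Longrightarrow> \<not> adj v u"
  using N_iff adj_sym N_not_W by blast

lemma sum_V: "sum f V = f u + sum f N + sum f W"
proof -
  have "sum f V = f u + sum f (N \<union> W)"
    using arg_cong[OF V_split, of "sum f"] by simp
  then show ?thesis
    using N_not_W by (subst (asm) sum.union_disjoint) (auto simp: add.assoc)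
qed

lemma sum_nbr_V_N: "v \<in> N \<Longrightarrow> sum f (nbr V v) = f u + sum f (nbr N v) + sum f (nbr W v)"
proof -
  assume v: "v \<in> N"
  have *: "nbr V v = insert u (nbr N v \<union> nbr W v)"
    by (subst V_split) (use N_adj_u[OF v] in auto)
  have "nbr N v \<inter> nbr W v = {}" using N_not_W by auto
  then show ?thesis
    unfolding * by (subst sum.insert) (auto simp: sum.union_disjoint add.assoc)
qed

lemma sum_nbr_V_W: "v \<in> W \<Longrightarrow> sum f (nbr V v) = sum f (nbr N v) + sum f (nbr W v)"
proof -
  assume v: "v \<in> W"
  have *: "nbr V v = nbr N v \<union> nbr W v"
    by (subst V_split) (use W_not_adj_u[OF v] in auto)
  have "nbr N v \<inter> nbr W v = {}" using N_not_W by auto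
  then show ?thesis
    unfolding * by (auto simp: sum.union_disjoint)
qed

lemma deg_V_N: "v \<in> N \<Longrightarrow> deg V v = 1 + deg N v + deg W v"
  using sum_nbr_V_N[of v "\<lambda>_. 1::real"] by (simp add: deg_def)

lemma deg_V_W: "v \<in> W \<Longrightarrow> deg V v = deg N v + deg W v"
  using sum_nbr_V_W[of v "\<lambda>_. 1::real"] by (simp add: deg_def)

lemma eigen_u: "\<rho> = sum x N"
  using eigen[OF u_in] x_u by (simp add: N_def)

lemma eigen_N: "v \<in> N \<Longrightarrow> \<rho> * x v = 1 + sum x (nbr N v) + sum x (nbr W v)"
  using eigen[OF N_V] sum_nbr_V_N[of v x] x_u by simp

lemma eigen_W: "v \<in> W \<Longrightarrow> \<rho> * x v = sum x (nbr N v) + sum x (nbr W v)"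
  using eigen[OF W_V] sum_nbr_V_W[of v x] by simp

lemma sum_x_nbr_N_le: "sum x (nbr N v) \<le> deg N v"
  and sum_x_nbr_W_le: "sum x (nbr W v) \<le> deg W v"
  using sum_nbr_deg_le[of N x v] sum_nbr_deg_le[of W x v] x_le_1 N_V W_V by auto

section \<open>Comparing the edge count with walks of length two from \<open>u\<close>\<close>

definition cost :: "'a \<Rightarrow> real" where
  "cost w = deg N w * (1 - x w) + deg W w / 2"

lemma cost_ge: "w \<in> W \<Longrightarrow> deg N w * (1 - x w) \<le> cost w"
  and cost_nonneg: "w \<in> W \<Longrightarrow> 0 \<le> cost w"
  using x_le_1[OF W_V] deg_nonneg by (auto simp: cost_def)

text \<open>Applying the eigenvector equation twice at \<open>u\<close> counts weighted walks of
  length two. Subtracting this from the edge count leaves \<open>cost w\<close> as the loss at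
  \<open>w\<close>: an edge to \<open>N\<close> has weight \<open>x w\<close> instead of 1, and an
  edge inside \<open>W\<close> is lost entirely. The \<open>- 1\<close> in
  \<open>deg N v - 1\<close> comes from \<open>\<rho> = sum x N\<close>.\<close>

lemma sum_cost_less:
  "sum cost W < 3 / 2 + (\<Sum>v\<in>N. (deg N v - 1) * x v - deg N v / 2)"
proof -
  have "\<rho>\<^sup>2 = (\<Sum>v\<in>N. \<rho> * x v)"
    by (simp add: power2_eq_square sum_distrib_left[symmetric] eigen_u[symmetric])
  also have "\<dots> = (\<Sum>v\<in>N. 1 + sum x (nbr N v) + sum x (nbr W v))"
    by (intro sum.cong refl eigen_N)
  also have "\<dots> = card N + (\<Sum>v\<in>N. deg N v * x v) + (\<Sum>w\<in>W. deg N w * x w)"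
    by (simp add: sum.distrib sum_nbr_swap)
  finally have 1: "\<rho>\<^sup>2 = card N + (\<Sum>v\<in>N. deg N v * x v) + (\<Sum>w\<in>W. deg N w * x w)" .
  have "(\<Sum>v\<in>N. deg W v) = (\<Sum>w\<in>W. deg N w)"
    using sum_nbr_swap[of N W "\<lambda>_. 1::real"] by (simp add: deg_def)
  moreover have "deg V u = card N" by (simp add: deg_def N_def)
  ultimately have 2: "(\<Sum>v\<in>V. deg V v) = 2 * card N + (\<Sum>v\<in>N. deg N v) + 2 * (\<Sum>w\<in>W. deg N w)
      + (\<Sum>w\<in>W. deg W w)"
    by (simp add: sum_V deg_V_N deg_V_W sum.distrib)
  show ?thesis using few_edges 1 2 eigen_u
    by (simp add: cost_def algebra_simps sum.distrib sum_subtractf sum_divide_distrib[symmetric])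
qed

text \<open>The path is one on three vertices inside \<open>N\<close>. If there is none, then
  \<open>v\<close> is the centre of a star component of \<open>G[N]\<close>, where an isolated
  vertex and either end of a single edge count as centres.\<close>

definition starts_path :: "'a \<Rightarrow> bool" where
  "starts_path v \<longleftrightarrow> (\<exists>a\<in>N. \<exists>b\<in>N. adj v a \<and> adj a b \<and> b \<noteq> v)"

text \<open>Since \<open>u\<close> is adjacent to the whole path, the rows \<open>b c d\<close> and
  \<open>a u e\<close> form a domino with shared edge \<open>c u\<close>.\<close>

lemma no_path5:
  assumes "distinct [a, b, c, d, e]" "{a, b, c, d, e} \<subseteq> N" "adj a b" "adj b c" "adj c d" "adj d e"
  shows False
proof -
  have "u \<notin> {a, b, c, d, e}" using assms u_notin by blast
  then show False
    using assms domino_free[of b c d a u e] by (auto simp: N_iff dest: adj_sym)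
qed

text \<open>A further neighbour \<open>z\<close> of \<open>w\<close> would give the domino with rows
  \<open>w v a\<close> and \<open>z u b\<close>, that is, the 4-cycles \<open>w v u z\<close> and
  \<open>v a b u\<close> sharing the edge \<open>v u\<close>.\<close>

lemma nbr_N_subset:
  assumes "w \<in> W" "v \<in> N" "a \<in> N" "b \<in> N" "adj v a" "adj a b" "b \<noteq> v" "adj w v"
  shows "nbr N w \<subseteq> {v, a, b}"
proof
  fix z assume z: "z \<in> nbr N w"
  show "z \<in> {v, a, b}"
  proof (rule ccontr)
    assume "z \<notin> {v, a, b}"
    moreover have S: "{v, a, b, z} \<subseteq> N" using assms z by auto
    moreover have "u \<notin> {v, a, b, z}" using S u_notin(1) by blast
    moreover have "w \<notin> {v, a, b, z}" using S N_not_W assms(1) by blast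
    moreover have "u \<noteq> w" using assms(1) u_notin(2) by blast
    moreover have "v \<noteq> a" "a \<noteq> b" using assms adj_irrefl by auto
    ultimately show False
      using assms z domino_free[of w v a z u b] by (auto simp: N_iff dest: adj_sym)
  qed
qed

lemma deg_N_le_3:
  assumes "w \<in> W" "v \<in> N" "starts_path v" "adj w v"
  shows "deg N w \<le> 3"
proof -
  obtain a b where "a \<in> N" "b \<in> N" "adj v a" "adj a b" "b \<noteq> v"
    using assms by (auto simp: starts_path_def)
  then have "nbr N w \<subseteq> {v, a, b}" using nbr_N_subset assms by blast
  then have "card (nbr N w) \<le> card {v, a, b}" by (intro card_mono) auto
  also have "\<dots> \<le> 3" by (simp add: card_insert_if)
  finally show ?thesis by (simp add: deg_def)
qed

text \<open>The eigenvector equation bounds \<open>\<rho> * x w\<close> by the degree of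
  \<open>w\<close>, and \<open>\<rho> / 2 \<ge> 5\<close> exceeds \<open>deg N w\<close>. Hence
  \<open>deg N w * x w\<close> is at most half of the degree of \<open>w\<close>.\<close>

lemma cost_ge_half_deg:
  assumes "w \<in> W" "deg N w \<le> 3"
  shows "deg N w / 2 \<le> cost w"
proof -
  have "\<rho> * x w \<le> deg N w + deg W w"
    using eigen_W[OF assms(1)] sum_x_nbr_N_le[of w] sum_x_nbr_W_le[of w] by linarith
  moreover have "0 \<le> x w * (\<rho> / 2 - deg N w)"
    using x_nonneg[OF W_V[OF assms(1)]] rho_ge assms(2) by (intro mult_nonneg_nonneg) auto
  ultimately show ?thesis by (simp add: cost_def algebra_simps)
qed

text \<open>Half of the edges from \<open>w \<in> W\<close> to path-starting vertices can be charged to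
  \<open>cost w\<close>, so they may be subtracted on the side of \<open>N\<close>.\<close>

definition gain :: "'a \<Rightarrow> real" where
  "gain v = (deg N v - 1) * x v - deg N v / 2 - (if starts_path v then deg W v / 2 else 0)"

text \<open>Only those \<open>w\<close> are charged that have a path-starting neighbour. By
  \<open>deg_N_le_3\<close> they have at most three neighbours in \<open>N\<close>, so
  \<open>cost w\<close> covers half of them.\<close>

lemma sum_gain: "- (3 / 2) < sum gain N"
proof -
  let ?P = "{v \<in> N. starts_path v}"
  have "(\<Sum>v\<in>N. if starts_path v then deg W v / 2 else 0) = (\<Sum>v\<in>?P. deg W v) / 2"
    unfolding sum_divide_distrib sum.inter_filter[OF finN] by (rule sum.cong) auto
  also have "(\<Sum>v\<in>?P. deg W v) = (\<Sum>w\<in>W. deg ?P w)"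
    using sum_nbr_swap[of ?P W "\<lambda>_. 1::real"] by (simp add: deg_def)
  also have "\<dots> / 2 = (\<Sum>w\<in>W. deg ?P w / 2)" by (simp add: sum_divide_distrib)
  also have "\<dots> \<le> sum cost W"
  proof (rule sum_mono)
    fix w assume w: "w \<in> W"
    show "deg ?P w / 2 \<le> cost w"
    proof (cases "deg ?P w = 0")
      case True
      then show ?thesis using cost_nonneg[OF w] by simp
    next
      case False
      then obtain v where "v \<in> N" "starts_path v" "adj w v"
        by (auto simp: deg_eq_0_iff)
      then have "deg N w / 2 \<le> cost w"
        using cost_ge_half_deg deg_N_le_3 w by blast
      moreover have "deg ?P w \<le> deg N w"
        unfolding deg_def by (auto intro!: card_mono)
      ultimately show ?thesis by simp
    qed
  qed
  finally show ?thesis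
    using sum_cost_less by (simp add: gain_def[abs_def] sum_subtractf)
qed

section \<open>Upper bounds for the gain of vertices and of components of
  \<open>G[N]\<close>\<close>

lemma gain_le: "gain v \<le> (deg N v - 1) * x v - deg N v / 2"
  using deg_nonneg by (simp add: gain_def)

lemma rho_x_le: "v \<in> N \<Longrightarrow> \<rho> * x v \<le> 1 + deg N v + deg W v"
  using eigen_N sum_x_nbr_N_le sum_x_nbr_W_le by (smt (verit))

lemma gain_leaf: "v \<in> N \<Longrightarrow> deg N v = 1 \<Longrightarrow> gain v \<le> - (1 / 2)"
  using gain_le[of v] by simp

text \<open>Inserting \<open>10 * x v \<le> 1 + deg N v + deg W v\<close> settles each degree
  separately. Degree 4 is the extreme case: it gives \<open>3 * 5 / 10 - 2 = - (1 / 2)\<close> when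
  \<open>deg W v = 0\<close>, and the subtracted \<open>deg W v / 2\<close> outweighs the edges to
  \<open>W\<close>.\<close>

lemma gain_small_deg:
  assumes "v \<in> N" "starts_path v" "deg N v \<le> 4"
  shows "gain v \<le> - (1 / 2)"
proof -
  have "deg N v \<noteq> 0" using assms by (auto simp: starts_path_def deg_eq_0_iff)
  moreover have "real (card (nbr N v)) \<le> real 4" using assms(3) by (simp add: deg_def)
  then have "card (nbr N v) \<le> 4" by linarith
  ultimately have d: "deg N v \<in> {1, 2, 3, 4}"
    unfolding deg_def by (auto simp del: card_eq_0_iff card_0_eq)
  have "10 * x v \<le> \<rho> * x v" using rho_ge x_nonneg N_V assms by (intro mult_right_mono) auto
  with rho_x_le[OF assms(1)] have *: "10 * x v \<le> 1 + deg N v + deg W v" by linarith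
  then show ?thesis using d deg_nonneg[of W v] assms(2)
    by (auto simp: gain_def)
qed

text \<open>These sets are the unions of components of \<open>G[N]\<close>; the least one containing
  a vertex is its component.\<close>

definition adj_closed :: "'a set \<Rightarrow> bool" where
  "adj_closed A \<longleftrightarrow> A \<subseteq> N \<and> (\<forall>v\<in>A. nbr N v \<subseteq> A)"

lemma adj_closed_N: "adj_closed N"
  by (auto simp: adj_closed_def)

lemma adj_closed_Diff: "adj_closed A \<Longrightarrow> adj_closed B \<Longrightarrow> adj_closed (A - B)"
  unfolding adj_closed_def
proof (intro conjI ballI subsetI)
  assume A: "A \<subseteq> N \<and> (\<forall>v\<in>A. nbr N v \<subseteq> A)" and B: "B \<subseteq> N \<and> (\<forall>v\<in>B. nbr N v \<subseteq> B)"
  show "v \<in> N" if "v \<in> A - B" for v using A that by blast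
  fix v w assume v: "v \<in> A - B" and w: "w \<in> nbr N v"
  have "v \<in> nbr N w" using A v w adj_commute by auto
  then show "w \<in> A - B" using A B v w by blast
qed

lemma adj_closed_finite: "adj_closed A \<Longrightarrow> finite A"
  unfolding adj_closed_def using finN finite_subset by blast

lemma star_nbr:
  assumes "c \<in> N" "\<not> starts_path c" "l \<in> nbr N c"
  shows "nbr N l = {c}"
  using assms by (auto simp: starts_path_def dest: adj_sym)

lemma deg_eq_1: "nbr A l = {c} \<Longrightarrow> deg A l = 1"
  by (simp add: deg_def)

lemma star_closed:
  assumes "c \<in> N" "\<not> starts_path c"
  shows "adj_closed (insert c (nbr N c))"
  using assms star_nbr[OF assms] unfolding adj_closed_def by auto

lemma sum_gain_leaves:
  assumes "finite A" "\<And>l. l \<in> A \<Longrightarrow> l \<in> N" "\<And>l. l \<in> A \<Longrightarrow> deg N l = 1"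
  shows "sum gain A \<le> - (card A / 2)"
proof -
  have "sum gain A \<le> (\<Sum>l\<in>A. - (1 / 2))" using assms by (intro sum_mono gain_leaf) auto
  then show ?thesis by simp
qed

text \<open>The leaves have degree 1 in \<open>N\<close>, so each contributes at most
  \<open>- (1 / 2)\<close>, which doubles the \<open>- deg N c / 2\<close> of the centre.\<close>

lemma star_gain:
  assumes "c \<in> N" "\<not> starts_path c"
  shows "sum gain (insert c (nbr N c)) \<le> (deg N c - 1) * x c - deg N c"
proof -
  have "sum gain (nbr N c) \<le> - (deg N c / 2)"
    unfolding deg_def using star_nbr[OF assms] deg_eq_1 by (intro sum_gain_leaves) auto
  then show ?thesis using gain_le[of c] adj_irrefl by simp
qed

lemma star_gain_le_neg1:
  assumes "c \<in> N" "\<not> starts_path c" "nbr N c \<noteq> {}"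
  shows "sum gain (insert c (nbr N c)) \<le> - 1"
proof -
  have "card (nbr N c) \<ge> 1" using assms by (simp add: Suc_le_eq card_gt_0_iff)
  then have "deg N c \<ge> 1" by (simp add: deg_def)
  then have "(deg N c - 1) * x c \<le> deg N c - 1"
    using x_le_1[OF N_V[OF assms(1)]] by (intro mult_left_le) auto
  then show ?thesis using star_gain[OF assms(1,2)] by linarith
qed

lemma star_gain_le_0:
  assumes "c \<in> N" "\<not> starts_path c"
  shows "sum gain (insert c (nbr N c)) \<le> 0"
proof (cases "nbr N c = {}")
  case True
  then show ?thesis using star_gain[OF assms] x_nonneg[OF N_V[OF assms(1)]] by (simp add: deg_def)
qed (use star_gain_le_neg1 assms in force)

lemma nbr_outside: "nbr A v \<noteq> B \<Longrightarrow> B \<subseteq> nbr A v \<Longrightarrow> \<exists>y\<in>nbr A v. y \<notin> B"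
  by blast

lemma card_ge_exists:
  assumes "finite A" "finite B" "card B < card A"
  shows "\<exists>l\<in>A. l \<notin> B"
  using assms by (meson card_mono linorder_not_less subsetI)

text \<open>With five neighbours available at \<open>c\<close>, the absence of paths on five
  vertices forces the component of \<open>c\<close> to be a star with the single extra edge
  \<open>{a, b}\<close>. Minimality of \<open>A\<close> among closed sets lets the component be
  peeled off any closed set containing \<open>c\<close>.\<close>

lemma star_plus_edge:
  assumes c: "c \<in> N" "5 \<le> card (nbr N c)" and ab: "a \<in> nbr N c" "b \<in> nbr N c" "adj a b"
  shows "\<exists>A. adj_closed A \<and> c \<in> A \<and>
    (\<forall>B. adj_closed B \<and> c \<in> B \<longrightarrow> A \<subseteq> B) \<and> sum gain A \<le> - (3 / 2)"
proof -
  let ?L = "nbr N c"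
  have ne: "a \<noteq> b" "c \<noteq> a" "c \<noteq> b" using ab adj_irrefl by auto
  have ab': "a \<in> N" "b \<in> N" "adj a c" "adj c a" "adj b c" "adj c b" "adj b a"
    using ab adj_commute by auto
  have other: "\<exists>l\<in>?L. l \<notin> {p, a, b}" for p
  proof -
    have "card {p, a, b} < card ?L" using c by (simp add: card_insert_if)
    then show ?thesis using card_ge_exists[of ?L "{p, a, b}"] by simp
  qed
  have leaf: "nbr N l = {c}" if l: "l \<in> ?L" "l \<notin> {a, b}" for l
  proof (rule ccontr)
    assume "nbr N l \<noteq> {c}"
    moreover have "{c} \<subseteq> nbr N l" using l c by (simp add: adj_commute)
    ultimately obtain y where "y \<in> nbr N l" "y \<notin> {c}"
      using nbr_outside[of N l "{c}"] by blast
    then have y: "y \<in> N" "adj l y" "y \<noteq> c" by simp_all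
    obtain k where k: "k \<in> ?L" "k \<notin> {l, a, b}" using other by blast
    have nel: "l \<noteq> c" "k \<noteq> c" "l \<noteq> y" using l k y adj_irrefl by auto
    have adjs: "l \<in> N" "adj l c" "adj y l" "k \<in> N" "adj c k"
      using l k y adj_commute by auto
    \<comment> \<open>Each alternative completes a path on five vertices: \<open>l a b c k\<close>,
      \<open>l b a c k\<close> or \<open>y l c a b\<close>.\<close>
    consider "y = a" | "y = b" | "y \<notin> {a, b}" by auto
    then show False
    proof cases
      case 1
      then show False using no_path5[of l a b c k] l y k nel ne ab(3) ab' adjs c by auto
    next
      case 2
      then show False using no_path5[of l b a c k] l y k nel ne ab(3) ab' adjs c by auto
    next
      case 3
      then show False using no_path5[of y l c a b] l y k nel ne ab(3) ab' adjs c by auto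
    qed
  qed
  have inner: "nbr N p = {q, c}" if pq: "(p, q) = (a, b) \<or> (p, q) = (b, a)" for p q
  proof (rule ccontr)
    assume "nbr N p \<noteq> {q, c}"
    moreover have "{q, c} \<subseteq> nbr N p" using pq ab(3) ab' c by auto
    ultimately obtain y where "y \<in> nbr N p" "y \<notin> {q, c}"
      using nbr_outside[of N p "{q, c}"] by blast
    then have y: "y \<in> N" "adj p y" "y \<noteq> q" "y \<noteq> c" by simp_all
    show False
    proof (cases "y \<in> ?L")
      case True
      then have "nbr N y = {c}" using leaf y pq adj_irrefl by auto
      moreover have "p \<in> nbr N y" using y pq ab' adj_commute by auto
      ultimately show False using pq ne by auto
    next
      case False
      obtain k where k: "k \<in> ?L" "k \<notin> {a, a, b}" using other by blast
      have nek: "k \<noteq> y" "k \<noteq> c" "y \<noteq> p" using k False y adj_irrefl by auto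
      have "adj y p" "k \<in> N" "adj c k" using y k adj_commute by auto
      moreover have "p \<in> N" "q \<in> N" "adj p q" "adj q c" "p \<noteq> q" "p \<noteq> c" "q \<noteq> c" "k \<noteq> p" "k \<noteq> q"
        using pq ab(3) ab' ne k by auto
      ultimately show False using no_path5[of y p q c k] y nek c by auto
    qed
  qed
  let ?A = "insert c ?L" and ?R = "?L - {a, b}"
  have closed: "adj_closed ?A"
    unfolding adj_closed_def
  proof (intro conjI ballI)
    show "?A \<subseteq> N" using c by auto
    fix v assume "v \<in> ?A"
    then consider "v = c" | "v = a" | "v = b" | "v \<in> ?L" "v \<notin> {a, b}" by auto
    then show "nbr N v \<subseteq> ?A"
      using leaf[of v] inner[of a b] inner[of b a] ab by cases auto
  qed
  have sumA: "sum gain ?A = gain c + gain a + gain b + sum gain ?R"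
  proof -
    have "?A = insert c (insert a (insert b ?R))" using ab by auto
    moreover have "c \<notin> ?L" using adj_irrefl by auto
    ultimately show ?thesis using ne by simp
  qed
  have "card ?R = card ?L - 2" using ab ne by (simp add: card_Diff_subset)
  then have cardR: "real (card ?R) = deg N c - 2" using c by (simp add: deg_def of_nat_diff)
  have "sum gain ?R \<le> - (card ?R / 2)"
    using leaf deg_eq_1 by (intro sum_gain_leaves) auto
  \<comment> \<open>With \<open>d = deg N c\<close>, this bound \<open>d / 2 - 1\<close> cancels
    exactly against the \<open>d - 2\<close> leaves, so only \<open>gain a + gain b\<close>
    remains.\<close>
  moreover have "gain c \<le> (deg N c - 1) - deg N c / 2"
  proof -
    have "(deg N c - 1) * x c \<le> deg N c - 1"
      using x_le_1[OF N_V[OF c(1)]] c(2) by (intro mult_left_le) (auto simp: deg_def)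
    then show ?thesis using gain_le[of c] by linarith
  qed
  moreover have "gain a + gain b \<le> - (3 / 2)"
  proof -
    have "deg N a = 2" "deg N b = 2"
      using inner[of a b] inner[of b a] ne by (simp_all add: deg_def)
    moreover have "starts_path a" "starts_path b"
      unfolding starts_path_def using ab(3) ab' c(1) ne by blast+
    ultimately have g: "gain a + gain b = x a + x b - 2 - (deg W a + deg W b) / 2"
      by (simp add: gain_def add_divide_distrib)
    \<comment> \<open>Adding the two inequalities with \<open>\<rho>\<close> replaced by 10 gives
      \<open>9 * (x a + x b) \<le> 4 + deg W a + deg W b\<close>, hence a gain of at most
      \<open>4 / 9 - 2\<close>, which is below \<open>- (3 / 2)\<close>.\<close>
    have "\<rho> * x a \<le> 2 + x b + deg W a" "\<rho> * x b \<le> 2 + x a + deg W b"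
      using eigen_N[of a] eigen_N[of b] inner[of a b] inner[of b a] ne ab
        sum_x_nbr_W_le[of a] sum_x_nbr_W_le[of b] x_le_1[OF N_V[OF c(1)]] by auto
    moreover have "10 * x a \<le> \<rho> * x a" "10 * x b \<le> \<rho> * x b"
      using rho_ge x_nonneg N_V ab by (auto intro!: mult_right_mono)
    ultimately show ?thesis using g deg_nonneg[of W a] deg_nonneg[of W b] by argo
  qed
  ultimately have "sum gain ?A \<le> - (3 / 2)" using sumA cardR by argo
  moreover have "?A \<subseteq> B" if "adj_closed B" "c \<in> B" for B
    using that by (auto simp: adj_closed_def)
  ultimately show ?thesis using closed by blast
qed

text \<open>Here the absence of paths on five vertices makes the component of \<open>c\<close> a
  double star: centres \<open>c\<close> and \<open>e\<close>, with the leaves \<open>?L\<close> at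
  \<open>c\<close> and \<open>?M\<close> at \<open>e\<close>.\<close>

lemma double_star:
  assumes c: "c \<in> N" "5 \<le> card (nbr N c)"
    and indep: "\<And>a b. a \<in> nbr N c \<Longrightarrow> b \<in> nbr N c \<Longrightarrow> \<not> adj a b"
    and e: "e \<in> nbr N c" and y0: "y0 \<in> nbr N e" "y0 \<noteq> c"
  shows "\<exists>A. adj_closed A \<and> c \<in> A \<and>
    (\<forall>B. adj_closed B \<and> c \<in> B \<longrightarrow> A \<subseteq> B) \<and> sum gain A \<le> - (3 / 2)"
proof -
  let ?L = "nbr N c - {e}" and ?M = "nbr N e - {c}"
  have eN: "e \<in> N" "adj c e" "adj e c" "e \<noteq> c" using e adj_irrefl adj_commute by auto
  have L_M: "?L \<inter> ?M = {}" using indep[of e] e by auto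
  have other: "\<exists>l\<in>?L. l \<noteq> p" for p
  proof -
    have "card {p, e} < card (nbr N c)" using c by (simp add: card_insert_if)
    then show ?thesis using card_ge_exists[of "nbr N c" "{p, e}"] by auto
  qed
  have leaf: "nbr N l = {c}" if l: "l \<in> ?L" for l
  proof (rule ccontr)
    assume "nbr N l \<noteq> {c}"
    moreover have "{c} \<subseteq> nbr N l" using l c by (simp add: adj_commute)
    ultimately obtain y where "y \<in> nbr N l" "y \<notin> {c}"
      using nbr_outside[of N l "{c}"] by blast
    then have y: "y \<in> N" "adj l y" "y \<noteq> c" by simp_all
    have yL: "y \<notin> nbr N c" using indep[of l y] l y by auto
    have y0L: "y0 \<notin> nbr N c" using indep[of e y0] e y0 by auto
    obtain k where k: "k \<in> ?L" "k \<noteq> l" using other by blast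
    have ne: "l \<noteq> c" "k \<noteq> c" "y \<noteq> l" "y \<noteq> k" "y \<noteq> e" "y0 \<noteq> l" "y0 \<noteq> k" "y0 \<noteq> e"
      using l k y y0 yL y0L e adj_irrefl by auto
    have adjs: "k \<in> N" "l \<in> N" "y0 \<in> N" "adj k c" "adj c l" "adj l c" "adj y l" "adj e y0" "adj y0 e"
      using l k y y0 adj_commute by auto
    \<comment> \<open>The forbidden path is \<open>k c l y0 e\<close> if \<open>l\<close> and
      \<open>e\<close> share the neighbour \<open>y0\<close>, and \<open>y l c e y0\<close>
      otherwise.\<close>
    show False
    proof (cases "y = y0")
      case True
      then show False using no_path5[of k c l y0 e] l k y y0(2) ne eN c adjs by auto
    next
      case False
      then show False using no_path5[of y l c e y0] l k y y0(2) ne eN c adjs by auto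
    qed
  qed
  have leaf': "nbr N y = {e}" if y: "y \<in> ?M" for y
  proof (rule ccontr)
    assume "nbr N y \<noteq> {e}"
    moreover have "{e} \<subseteq> nbr N y" using y eN by (simp add: adj_commute)
    ultimately obtain z where "z \<in> nbr N y" "z \<notin> {e}"
      using nbr_outside[of N y "{e}"] by blast
    then have z: "z \<in> N" "adj y z" "z \<noteq> e" by simp_all
    have yc: "y \<notin> nbr N c" using indep[of e y] e y by auto
    then have zc: "z \<noteq> c" using y z adj_commute by auto
    have zL: "z \<notin> ?L"
    proof
      assume "z \<in> ?L"
      then have "nbr N z = {c}" by (rule leaf)
      moreover have "y \<in> nbr N z" using y z adj_commute by auto
      ultimately show False using y by auto
    qed
    obtain k where k: "k \<in> ?L" using other by blast
    have "k \<noteq> z" "k \<noteq> c" "k \<noteq> y" "y \<noteq> z" "y \<noteq> e" using k zL yc y z adj_irrefl by auto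
    moreover have "adj z y" "adj y e" "k \<in> N" "adj c k" "k \<noteq> e" using y z k adj_commute by auto
    ultimately show False using no_path5[of z y e c k] y z zc eN c by auto
  qed
  let ?A = "insert c (insert e (?L \<union> ?M))"
  have closed: "adj_closed ?A"
    unfolding adj_closed_def
  proof (intro conjI ballI)
    show AN: "?A \<subseteq> N" using c eN by auto
    fix v assume "v \<in> ?A"
    then consider "v = c" | "v = e" | "v \<in> ?L" | "v \<in> ?M" by blast
    then show "nbr N v \<subseteq> ?A"
      using leaf[of v] leaf'[of v] by cases auto
  qed
  have sumA: "sum f ?A = f c + f e + sum f ?L + sum f ?M" for f :: "'a \<Rightarrow> real"
  proof -
    have "c \<notin> insert e (?L \<union> ?M)" "e \<notin> ?L \<union> ?M"
      using adj_irrefl eN(4) by simp_all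
    moreover have "sum f (?L \<union> ?M) = sum f ?L + sum f ?M"
      by (rule sum.union_disjoint[OF _ _ L_M]) simp_all
    ultimately show ?thesis
      by (metis (no_types, lifting) add.assoc finN finite_Diff finite_UnI finite_insert finite_nbr sum.insert)
  qed
  define p q where "p = real (card ?L)" and "q = real (card ?M)"
  have cM: "c \<in> nbr N e" using c eN by simp
  have "card ?M > 0" using y0 by (auto simp: card_gt_0_iff)
  then have q: "q \<ge> 1" by (simp add: q_def)
  have pc: "card (nbr N c) = Suc (card ?L)" using e by (intro card.remove) simp_all
  then have p: "p \<ge> 1" using c by (simp add: p_def)
  have dc: "deg N c = p + 1" using pc by (simp add: deg_def p_def)
  have "card (nbr N e) = Suc (card ?M)" using cM by (intro card.remove) auto
  then have de: "deg N e = q + 1" by (simp add: deg_def q_def)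
  have gL: "sum gain ?L \<le> - (p / 2)"
    unfolding p_def using leaf deg_eq_1 by (intro sum_gain_leaves) auto
  have gM: "sum gain ?M \<le> - (q / 2)"
    unfolding q_def using leaf' deg_eq_1 by (intro sum_gain_leaves) auto
  obtain k where k: "k \<in> ?L" using other by blast
  have "starts_path c"
    unfolding starts_path_def using e y0 by auto
  then have gc: "gain c = p * x c - (p + 1) / 2 - deg W c / 2"
    by (simp add: gain_def dc)
  have "starts_path e"
    unfolding starts_path_def using eN c k by auto
  then have ge: "gain e = q * x e - (q + 1) / 2 - deg W e / 2"
    by (simp add: gain_def de)
  have "(p - 1) * x c \<le> p - 1" "(q - 1) * x e \<le> q - 1"
    using p q x_le_1[OF N_V[OF c(1)]] x_le_1[OF N_V[OF eN(1)]] by (auto intro!: mult_left_le)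
  then have pq: "p * x c \<le> x c + p - 1" "q * x e \<le> x e + q - 1" by (simp_all add: algebra_simps)
  \<comment> \<open>The neighbourhoods of \<open>c\<close> and \<open>e\<close> in \<open>N\<close>
    partition the component, whose total weight is at most \<open>sum x N = \<rho>\<close>. So
    adding the two eigenvector equations keeps \<open>x c + x e\<close> close to 1.\<close>
  have "sum x ?A \<le> \<rho>"
    unfolding eigen_u using closed x_nonneg N_V
    by (intro sum_mono2) (auto simp: adj_closed_def)
  moreover have "sum x (nbr N c) = x e + sum x ?L" using e by (intro sum.remove) simp_all
  moreover have "sum x (nbr N e) = x c + sum x ?M" using cM by (intro sum.remove) auto
  ultimately have "\<rho> * x c + \<rho> * x e \<le> 2 + \<rho> + deg W c + deg W e"
    using eigen_N[OF c(1)] eigen_N[OF eN(1)] sumA[of x] sum_x_nbr_W_le[of c] sum_x_nbr_W_le[of e]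
    by linarith
  then have *: "\<rho> * (x c + x e - 1) \<le> 2 + deg W c + deg W e" by (simp add: algebra_simps)
  \<comment> \<open>Lowering \<open>\<rho>\<close> to 10 needs a nonnegative factor, hence the case
    split.\<close>
  have "10 * (x c + x e - 1) \<le> 2 + deg W c + deg W e"
  proof (cases "x c + x e - 1 \<le> 0")
    case False
    then have "10 * (x c + x e - 1) \<le> \<rho> * (x c + x e - 1)"
      using rho_ge by (intro mult_right_mono) auto
    then show ?thesis using * by (rule order_trans)
  next
    case True
    then have "10 * (x c + x e - 1) \<le> 0" by simp
    also have "0 \<le> 2 + deg W c + deg W e" using deg_nonneg by (intro add_nonneg_nonneg) auto
    finally show ?thesis .
  qed
  \<comment> \<open>The gain is at most \<open>x c + x e - 3 - (deg W c + deg W e) / 2\<close>, and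
    \<open>x c + x e \<le> 6 / 5 + (deg W c + deg W e) / 10\<close> makes this at most
    \<open>- (9 / 5)\<close>.\<close>
  then have "sum gain ?A \<le> - (3 / 2)"
    using sumA[of gain] gL gM gc ge pq deg_nonneg[of W c] deg_nonneg[of W e] by argo
  moreover have "?A \<subseteq> B" if B: "adj_closed B" "c \<in> B" for B
  proof -
    have "nbr N c \<subseteq> B" using B by (auto simp: adj_closed_def)
    moreover from this have "nbr N e \<subseteq> B" using B e unfolding adj_closed_def by blast
    ultimately show ?thesis using B e by blast
  qed
  ultimately show ?thesis using closed by blast
qed

lemma large_deg_gain:
  assumes c: "c \<in> N" "starts_path c" "4 < deg N c"
  shows "\<exists>A. adj_closed A \<and> c \<in> A \<and>
    (\<forall>B. adj_closed B \<and> c \<in> B \<longrightarrow> A \<subseteq> B) \<and> sum gain A \<le> - (3 / 2)"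
proof -
  have 5: "5 \<le> card (nbr N c)" using c(3) by (simp add: deg_def)
  obtain e y where ey: "e \<in> nbr N c" "y \<in> nbr N e" "y \<noteq> c"
    using c by (auto simp: starts_path_def)
  show ?thesis
  proof (cases "\<exists>a\<in>nbr N c. \<exists>b\<in>nbr N c. adj a b")
    case True
    then show ?thesis using star_plus_edge[OF c(1) 5] by blast
  next
    case False
    then show ?thesis using double_star[OF c(1) 5 _ ey] by blast
  qed
qed

section \<open>From the total gain to the structure of the graph\<close>

lemma closed_gain_split:
  assumes "adj_closed A" "B \<subseteq> A"
  shows "sum gain A = sum gain B + sum gain (A - B)"
  using assms adj_closed_finite[of A] by (simp add: sum.subset_diff)

text \<open>Star components and components with a large-degree vertex are peeled off by induction.
  What is left consists of path-starting vertices of degree at most 4, each of negative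
  gain.\<close>

lemma sum_gain_closed:
  assumes "adj_closed A"
  shows "sum gain A \<le> 0"
  using assms
proof (induction "card A" arbitrary: A rule: less_induct)
  case less
  have finA: "finite A" using less.prems by (rule adj_closed_finite)
  show ?case
  proof (cases "\<exists>v\<in>A. \<not> starts_path v \<or> 4 < deg N v")
    case True
    then obtain v where v: "v \<in> A" "\<not> starts_path v \<or> 4 < deg N v" by blast
    have vN: "v \<in> N" using v less.prems by (auto simp: adj_closed_def)
    have "\<exists>B. adj_closed B \<and> v \<in> B \<and> B \<subseteq> A \<and> sum gain B \<le> 0"
    proof (cases "starts_path v")
      case True
      then obtain B where "adj_closed B" "v \<in> B" "B \<subseteq> A" "sum gain B \<le> - (3 / 2)"
        using large_deg_gain[of v] v vN less.prems by blast
      then show ?thesis by (intro exI[of _ B]) simp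
    next
      case False
      then show ?thesis
        using star_closed[OF vN] star_gain_le_0[OF vN] less.prems v
        by (intro exI[of _ "insert v (nbr N v)"]) (auto simp: adj_closed_def)
    qed
    then obtain B where B: "adj_closed B" "v \<in> B" "B \<subseteq> A" "sum gain B \<le> 0" by blast
    have "card (A - B) < card A" using B v finA by (intro psubset_card_mono) auto
    then have "sum gain (A - B) \<le> 0" using less B adj_closed_Diff by blast
    then show ?thesis using closed_gain_split[OF less.prems B(3)] B by simp
  next
    case False
    have "sum gain A \<le> (\<Sum>v\<in>A. 0)"
    proof (rule sum_mono)
      fix v assume "v \<in> A"
      moreover have "v \<in> N" using less.prems \<open>v \<in> A\<close> by (auto simp: adj_closed_def)
      ultimately show "gain v \<le> 0" using gain_small_deg[of v] False by force
    qed
    then show ?thesis by simp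
  qed
qed

text \<open>The complement of \<open>A\<close> in \<open>N\<close> is closed as well and has gain at
  most 0. In particular no component as in \<open>large_deg_gain\<close> exists.\<close>

lemma closed_gain_gt: "adj_closed A \<Longrightarrow> - (3 / 2) < sum gain A"
  using closed_gain_split[OF adj_closed_N, of A] sum_gain sum_gain_closed[of "N - A"]
    adj_closed_Diff[OF adj_closed_N, of A] by (auto simp: adj_closed_def)

text \<open>The vertices outside all stars form a closed set \<open>Z\<close> in which every vertex
  has gain at most \<open>- (1 / 2)\<close>. If \<open>Z\<close> is nonempty, it contains a path on
  three vertices and hence has gain at most \<open>- (3 / 2)\<close>, against
  \<open>closed_gain_gt\<close>.\<close>

lemma nbr_of_star_centre:
  assumes v: "v \<in> N"
  shows "\<exists>c\<in>N. \<not> starts_path c \<and> v \<in> insert c (nbr N c)"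
proof -
  define Z where "Z = N - (\<Union>c\<in>{c \<in> N. \<not> starts_path c}. insert c (nbr N c))"
  have closed: "adj_closed Z"
    unfolding adj_closed_def
  proof (intro conjI ballI subsetI)
    show "z \<in> N" if "z \<in> Z" for z using that by (simp add: Z_def)
    fix z y assume z: "z \<in> Z" and y: "y \<in> nbr N z"
    show "y \<in> Z"
    proof (rule ccontr)
      assume "y \<notin> Z"
      then obtain c where c: "c \<in> N" "\<not> starts_path c" "y \<in> insert c (nbr N c)"
        using y by (auto simp: Z_def)
      moreover have "z \<in> nbr N y" using z y by (auto simp: Z_def adj_commute)
      ultimately have "z \<in> insert c (nbr N c)"
        using star_closed[OF c(1,2)] unfolding adj_closed_def by blast
      then show False using z c by (auto simp: Z_def)
    qed
  qed
  have P: "z \<in> N" "starts_path z" "deg N z \<le> 4" if "z \<in> Z" for z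
  proof -
    show 1: "z \<in> N" "starts_path z" using that by (auto simp: Z_def)
    show "deg N z \<le> 4"
      using large_deg_gain[OF 1] closed_gain_gt by force
  qed
  have "v \<notin> Z"
  proof
    assume vZ: "v \<in> Z"
    obtain a b where ab: "a \<in> N" "b \<in> N" "adj v a" "adj a b" "b \<noteq> v"
      using P[OF vZ] by (auto simp: starts_path_def)
    then have "a \<in> nbr N v" "b \<in> nbr N a" by simp_all
    then have "a \<in> Z" "b \<in> Z" using closed vZ unfolding adj_closed_def by blast+
    moreover have "v \<noteq> a" "a \<noteq> b" using ab adj_irrefl by auto
    ultimately have "card {v, a, b} = 3" using ab by simp
    moreover have "card {v, a, b} \<le> card Z"
      using vZ \<open>a \<in> Z\<close> \<open>b \<in> Z\<close> adj_closed_finite[OF closed] by (intro card_mono) auto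
    moreover have "sum gain Z \<le> (\<Sum>z\<in>Z. - (1 / 2))"
      using P gain_small_deg by (intro sum_mono) blast
    ultimately show False using closed_gain_gt[OF closed] by simp
  qed
  then obtain c where "c \<in> {c \<in> N. \<not> starts_path c}" "v \<in> insert c (nbr N c)"
    using v unfolding Z_def by blast
  then show ?thesis by blast
qed

text \<open>Without a star that has an edge, the gain would be at most \<open>- \<rho>\<close>. Two
  such stars would have gain at most \<open>- 2\<close>. Both contradict
  \<open>sum_gain\<close>.\<close>

lemma N_star:
  obtains c where "c \<in> N" "nbr N c \<noteq> {}" "\<not> starts_path c"
    "\<And>i. i \<in> N - insert c (nbr N c) \<Longrightarrow> nbr N i = {}"
proof -
  have "\<exists>c\<in>N. nbr N c \<noteq> {} \<and> \<not> starts_path c"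
  proof (rule ccontr)
    assume *: "\<not> ?thesis"
    have "nbr N v = {}" if "v \<in> N" for v
    proof -
      obtain c where "c \<in> N" "\<not> starts_path c" "v \<in> insert c (nbr N c)"
        using nbr_of_star_centre[OF \<open>v \<in> N\<close>] by blast
      then show ?thesis using * by blast
    qed
    then have "gain v \<le> - x v" if "v \<in> N" for v
      using gain_le[of v] that by (simp add: deg_def)
    then have "sum gain N \<le> (\<Sum>v\<in>N. - x v)" by (rule sum_mono)
    then show False using sum_gain eigen_u rho_ge by (simp add: sum_negf)
  qed
  then obtain c where c: "c \<in> N" "nbr N c \<noteq> {}" "\<not> starts_path c" by blast
  let ?S = "insert c (nbr N c)"
  have S: "adj_closed ?S" "?S \<subseteq> N" "sum gain ?S \<le> - 1"
    using star_closed star_gain_le_neg1 c by auto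
  have "nbr N i = {}" if i: "i \<in> N - ?S" for i
  proof (rule ccontr)
    assume ne: "nbr N i \<noteq> {}"
    obtain d where d: "d \<in> N" "\<not> starts_path d" "i \<in> insert d (nbr N d)"
      using nbr_of_star_centre[OF DiffD1[OF i]] by blast
    let ?T = "insert d (nbr N d)"
    have "nbr N d \<noteq> {}" using d ne by auto
    then have T: "adj_closed ?T" "?T \<subseteq> N" "sum gain ?T \<le> - 1"
      using star_closed star_gain_le_neg1 d by auto
    have cl: "adj_closed (N - ?S)" using adj_closed_Diff[OF adj_closed_N S(1)] .
    have "d \<in> nbr N i \<or> d = i" using d i by (auto simp: adj_commute)
    then have "d \<in> N - ?S" using cl i unfolding adj_closed_def by blast
    then have "?T \<subseteq> N - ?S" using cl unfolding adj_closed_def by blast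
    then show False
      using closed_gain_split[OF adj_closed_N S(2)] closed_gain_split[OF cl, of ?T]
        sum_gain_closed[OF adj_closed_Diff[OF cl T(1)]] S(3) T(3) sum_gain by linarith
  qed
  then show ?thesis using that c by blast
qed

text \<open>The single star uses up 1 of the slack \<open>3 / 2\<close>, so every \<open>w\<close>
  in \<open>W\<close> has \<open>cost w < 1 / 2\<close>. Then \<open>w\<close> has no neighbour in
  \<open>W\<close>, hence one in \<open>N\<close>, and its weight is so small that one such edge
  already costs more.\<close>

lemma star_structure:
  assumes noiso: "\<And>v. v \<in> V \<Longrightarrow> \<exists>w. adj v w"
  obtains c where "c \<in> N" "V = insert u N"
    "\<And>l. l \<in> nbr N c \<Longrightarrow> nbr V l = {u, c}"
    "\<And>i. i \<in> N - insert c (nbr N c) \<Longrightarrow> nbr V i = {u}"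
proof -
  obtain c where c: "c \<in> N" "nbr N c \<noteq> {}" "\<not> starts_path c"
    and iso: "\<And>i. i \<in> N - insert c (nbr N c) \<Longrightarrow> nbr N i = {}"
    using N_star by blast
  note leaf = star_nbr[OF c(1,3)]
  define L I where "L = nbr N c" and "I = N - insert c L"
  have fin: "finite L" "finite I" by (simp_all add: L_def I_def)
  have N_sum: "sum f N = f c + sum f L + sum f I" for f :: "'a \<Rightarrow> real"
  proof -
    have "N = insert c (L \<union> I)" using c by (auto simp: L_def I_def)
    moreover have "c \<notin> L \<union> I" "L \<inter> I = {}" using adj_irrefl by (auto simp: L_def I_def)
    ultimately show ?thesis using fin by (simp add: sum.union_disjoint add.assoc)
  qed
  define r where "r = real (card L)"
  have "card L > 0" using c(2) fin by (simp add: card_gt_0_iff L_def)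
  then have r1: "r \<ge> 1" by (simp add: r_def)
  have xc: "x c \<le> 1" using x_le_1 N_V c by blast
  have sL: "sum (\<lambda>v. (deg N v - 1) * x v - deg N v / 2) L = - (r / 2)"
    using leaf deg_eq_1 by (simp add: L_def r_def)
  have sI: "sum (\<lambda>v. (deg N v - 1) * x v - deg N v / 2) I = - sum x I"
    using iso by (simp add: L_def I_def deg_def sum_negf)
  have dc: "deg N c = r" by (simp add: deg_def r_def L_def)
  have xI: "0 \<le> sum x I" using x_nonneg N_V by (auto intro!: sum_nonneg simp: I_def)
  have "(r - 1) * x c \<le> r - 1" using r1 xc by (intro mult_left_le) auto
  \<comment> \<open>The star contributes at most \<open>(r - 1) - r / 2 - r / 2 = - 1\<close>, and
    each isolated vertex \<open>i\<close> of \<open>G[N]\<close> contributes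
    \<open>- x i\<close>.\<close>
  then have main: "sum cost W + sum x I < 1 / 2"
    using sum_cost_less by (simp add: N_sum sL sI dc)
  have costW: "0 \<le> sum cost W" by (intro sum_nonneg cost_nonneg)
  have "sum x L \<le> r"
    using sum_mono[of L x "\<lambda>_. 1"] x_le_1 N_V by (simp add: r_def L_def)
  \<comment> \<open>From \<open>10 \<le> \<rho> < 1 + r + 1 / 2\<close>. Three leaves suffice below:
    two must remain besides a given one.\<close>
  then have "r > 3"
    using eigen_u N_sum[of x] xc rho_ge main costW by linarith
  then have cardL: "3 \<le> card L" by (simp add: r_def)
  have cost_w: "cost w < 1 / 2" if "w \<in> W" for w
    using member_le_sum[OF that, of cost] cost_nonneg main xI by auto
  have "W = {}"
  proof (rule ccontr)
    assume "W \<noteq> {}"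
    have dW: "deg W w = 0" if w: "w \<in> W" for w
    proof -
      have "deg N w * (1 - x w) \<ge> 0"
        using x_le_1[OF W_V[OF w]] deg_nonneg by simp
      then have "deg W w < 1" using cost_w[OF w] by (simp add: cost_def)
      then show ?thesis by (simp add: deg_def)
    qed
    obtain w where w: "w \<in> W" using \<open>W \<noteq> {}\<close> by blast
    have W0: "nbr W w = {}" using dW[OF w] by (simp add: deg_def)
    obtain z where "adj w z" using noiso W_V[OF w] by blast
    moreover from this have "z \<in> insert u (N \<union> W)" using adj_V' V_split by blast
    ultimately have "z \<in> nbr N w" using W0 W_not_adj_u[OF w] by (auto simp: nbr_def)
    then have "card (nbr N w) > 0" by (auto simp: card_gt_0_iff)
    then have d1: "deg N w \<ge> 1" by (simp add: deg_def)
    have rw: "\<rho> * x w = sum x (nbr N w)" using eigen_W[OF w] W0 by simp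
    have "\<rho> * x w \<le> 2"
    proof (cases "\<exists>l\<in>L. adj w l")
      case True
      then obtain l where l: "l \<in> L" "adj w l" by blast
      have lc: "l \<in> N" "adj l c" using l by (auto simp: L_def adj_commute)
      \<comment> \<open>This uses the path \<open>l c k\<close> in \<open>N\<close>; two different
        choices of \<open>k\<close> then leave only \<open>l\<close> and \<open>c\<close>.\<close>
      have sub: "nbr N w \<subseteq> {l, c, k}" if "k \<in> L" "k \<noteq> l" for k
        using nbr_N_subset[OF w lc(1) c(1), of k] lc l that by (auto simp: L_def)
      have other: "\<exists>k\<in>L. k \<noteq> l \<and> k \<noteq> p" for p
      proof -
        have "card {l, p} < card L" using cardL by (simp add: card_insert_if)
        then show ?thesis using card_ge_exists[of L "{l, p}"] fin by simp
      qed
      obtain k where k: "k \<in> L" "k \<noteq> l" using other by blast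
      obtain k' where k': "k' \<in> L" "k' \<noteq> l" "k' \<noteq> k" using other by blast
      have "nbr N w \<subseteq> {l, c}" using sub[OF k] sub[OF k'(1,2)] k'(3) by auto
      then have "card (nbr N w) \<le> card {l, c}" by (intro card_mono) auto
      also have "\<dots> \<le> 2" by (simp add: card_insert_if)
      finally have "deg N w \<le> 2" by (simp add: deg_def)
      then show ?thesis using rw sum_x_nbr_N_le[of w] by linarith
    next
      case False
      \<comment> \<open>By \<open>main\<close> the total weight of \<open>I\<close> is below
        \<open>1 / 2\<close>, however many vertices of \<open>I\<close> are adjacent to
        \<open>w\<close>.\<close>
      then have "nbr N w \<subseteq> insert c I" by (auto simp: I_def)
      then have "sum x (nbr N w) \<le> sum x (insert c I)"
        using x_nonneg N_V c fin by (intro sum_mono2) (auto simp: I_def)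
      also have "\<dots> = x c + sum x I" using fin by (simp add: I_def)
      finally show ?thesis using rw xc main costW by linarith
    qed
    moreover have "10 * x w \<le> \<rho> * x w"
      using rho_ge x_nonneg[OF W_V[OF w]] by (intro mult_right_mono)
    ultimately have "x w \<le> 1 / 5" by linarith
    \<comment> \<open>So \<open>w\<close> costs at least \<open>4 / 5\<close>, against the bound
      \<open>1 / 2\<close>.\<close>
    then have "1 * (4 / 5) \<le> deg N w * (1 - x w)" using d1 by (intro mult_mono) auto
    then show False using cost_ge[OF w] cost_w[OF w] by linarith
  qed
  then have VN: "V = insert u N" using V_split by (metis Un_empty_right)
  have nbrV: "nbr V v = insert u (nbr N v)" if "v \<in> N" for v
    by (subst VN) (use N_adj_u[OF that] in auto)
  show ?thesis
  proof (rule that[OF c(1) VN])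
    show "nbr V l = {u, c}" if "l \<in> nbr N c" for l
      using nbrV leaf[OF that] that by auto
    show "nbr V i = {u}" if "i \<in> N - insert c (nbr N c)" for i
      using nbrV iso[OF that] that by auto
  qed
qed

text \<open>Multiplying the equations at \<open>u\<close> and \<open>c\<close> by \<rho> eliminates
  the leaves and the isolated vertices of \<open>G[N]\<close>. Eliminating \<open>x c\<close> from
  the two results gives the quartic in the form \<open>(\<rho>\<^sup>2 - r - s) * (\<rho>\<^sup>2 -
  r) = (\<rho> + r)\<^sup>2\<close>.\<close>

lemma star_equations:
  assumes c: "c \<in> N" "V = insert u N"
    and L: "\<And>l. l \<in> nbr N c \<Longrightarrow> nbr V l = {u, c}"
    and I: "\<And>i. i \<in> N - insert c (nbr N c) \<Longrightarrow> nbr V i = {u}"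
  defines "r \<equiv> real (card (nbr N c))" and "s \<equiv> real (card (N - insert c (nbr N c)))"
  shows "(\<Sum>v\<in>V. deg V v) = 2 * (2 * r + s + 1)"
    and "\<rho> ^ 4 - (2 * r + s + 1) * \<rho>\<^sup>2 - 2 * r * \<rho> + r * s = 0"
proof -
  let ?L = "nbr N c" and ?I = "N - insert c (nbr N c)"
  have N_sum: "sum f N = f c + sum f ?L + sum f ?I" for f :: "'a \<Rightarrow> real"
  proof -
    have "N = insert c (?L \<union> ?I)" using c(1) by auto
    moreover have "c \<notin> ?L \<union> ?I" "?L \<inter> ?I = {}" using adj_irrefl by auto
    ultimately show ?thesis by (metis (no_types, lifting) add.assoc finN finite_Diff finite_UnI finite_nbr sum.insert sum.union_disjoint)
  qed
  have uc: "u \<noteq> c" using c(1) u_notin by blast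
  have nc: "nbr V c = insert u ?L" by (subst c(2)) (use N_adj_u[OF c(1)] in auto)
  have "deg V u = card N" by (simp add: deg_def N_def)
  then have du: "deg V u = 1 + r + s" using N_sum[of "\<lambda>_. 1"] by (simp add: r_def s_def)
  have dc: "deg V c = 1 + r" using nc by (simp add: deg_def r_def)
  have "sum (deg V) ?L = 2 * r" using L uc by (simp add: deg_def r_def)
  moreover have "sum (deg V) ?I = s" using I by (simp add: deg_def s_def)
  moreover have "sum (deg V) V = deg V u + sum (deg V) N"
    using arg_cong[OF c(2), of "sum (deg V)"] by simp
  ultimately show "(\<Sum>v\<in>V. deg V v) = 2 * (2 * r + s + 1)"
    using du dc N_sum[of "deg V"] by simp
  have eL: "\<rho> * x l = 1 + x c" if "l \<in> ?L" for l
    using eigen[of l] L[OF that] that N_V uc x_u by auto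
  have eI: "\<rho> * x i = 1" if "i \<in> ?I" for i
    using eigen[of i] I[OF that] that N_V x_u by auto
  have sL: "\<rho> * sum x ?L = r * (1 + x c)" using eL by (simp add: sum_distrib_left r_def)
  have sI: "\<rho> * sum x ?I = s" using eI by (simp add: sum_distrib_left s_def)
  have "\<rho> * \<rho> = \<rho> * x c + \<rho> * sum x ?L + \<rho> * sum x ?I"
    by (subst (2) eigen_u) (simp add: N_sum algebra_simps)
  then have 1: "\<rho>\<^sup>2 - r - s = (\<rho> + r) * x c"
    unfolding sL sI by (simp add: power2_eq_square algebra_simps)
  have "\<rho> * x c = 1 + sum x ?L" using eigen[of c] nc c(1) N_V x_u u_notin by auto
  then have "\<rho> * (\<rho> * x c) = \<rho> + r * (1 + x c)" using sL by (simp add: distrib_left)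
  then have 2: "(\<rho>\<^sup>2 - r) * x c = \<rho> + r" by (simp add: power2_eq_square algebra_simps)
  have "(\<rho>\<^sup>2 - r - s) * (\<rho>\<^sup>2 - r) = (\<rho> + r) * ((\<rho>\<^sup>2 - r) * x c)"
    unfolding 1 by (simp add: mult_ac)
  then have "(\<rho>\<^sup>2 - r - s) * (\<rho>\<^sup>2 - r) = (\<rho> + r) * (\<rho> + r)" unfolding 2 .
  then show "\<rho> ^ 4 - (2 * r + s + 1) * \<rho>\<^sup>2 - 2 * r * \<rho> + r * s = 0"
    by (simp add: algebra_simps power2_eq_square power4_eq_xxxx)
qed

end

section \<open>Spectral radius of a finite graph\<close>

text \<open>Near 0 the linear term dominates; \<open>t = - b / d\<close> with \<open>d\<close> above
  \<open>\<bar>c\<bar>\<close> makes the value negative unless \<open>b = 0\<close>.\<close>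

lemma quadratic_nonneg_linear_coeff:
  fixes b c :: real
  assumes "\<And>t. 0 \<le> 2 * t * b + t\<^sup>2 * c"
  shows "b = 0"
proof (rule ccontr)
  assume b: "b \<noteq> 0"
  define d where "d = \<bar>c\<bar> + 1"
  have d: "d > 0" "c < d" by (auto simp: d_def)
  have "(2 * (- b / d) * b + (- b / d)\<^sup>2 * c) * d\<^sup>2 = b\<^sup>2 * (c - 2 * d)"
    using d by (simp add: field_simps power2_eq_square)
  also have "\<dots> < 0" using b d by (intro mult_pos_neg) auto
  finally have "2 * (- b / d) * b + (- b / d)\<^sup>2 * c < 0"
    using d by (simp add: mult_less_0_iff)
  then show False using assms[of "- b / d"] by simp
qed

text \<open>A maximiser of the Rayleigh quotient exists by compactness. Taking absolute values keeps
  it maximal because the entries are nonnegative, and a first-order variation shows that it is an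
  eigenvector.\<close>

lemma max_eigenvalue_symmetric_nonneg:
  fixes A :: "'a \<Rightarrow> 'a \<Rightarrow> real"
  assumes fin: "finite V" and ne: "V \<noteq> {}"
    and sym: "\<And>v w. A v w = A w v" and nonneg: "\<And>v w. 0 \<le> A v w"
  shows "\<exists>k x. (\<forall>v. 0 \<le> x v) \<and> (\<exists>v\<in>V. x v \<noteq> 0) \<and>
    (\<forall>v\<in>V. (\<Sum>w\<in>V. A v w * x w) = k * x v) \<and>
    (\<forall>l y. (\<exists>v\<in>V. y v \<noteq> 0) \<longrightarrow> (\<forall>v\<in>V. (\<Sum>w\<in>V. A v w * y w) = l * y v) \<longrightarrow> l \<le> k)"
proof -
  define B where "B y z = (\<Sum>v\<in>V. z v * (\<Sum>w\<in>V. A v w * y w))" for y z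
  define n where "n y = (\<Sum>v\<in>V. (y v)\<^sup>2)" for y :: "'a \<Rightarrow> real"
  \<comment> \<open>The unit sphere of the functions vanishing outside \<open>V\<close>, cut out of
    a product of compact intervals so that Tychonoff's theorem gives compactness.\<close>
  define K where "K = (Pi\<^sub>E UNIV (\<lambda>v. if v \<in> V then {-1..1::real} else {0})) \<inter> {y. n y = 1}"
  have cont_n: "continuous_on UNIV n"
    unfolding n_def by (intro continuous_intros continuous_on_product_coordinates)
  have cont_B: "continuous_on S (\<lambda>y. B y y)" for S
    unfolding B_def
    by (intro continuous_intros continuous_on_subset[OF continuous_on_product_coordinates]) auto
  have "compact (Pi\<^sub>E UNIV (\<lambda>v. if v \<in> V then {-1..1::real} else {0}))"
    unfolding euclidean_product_topology[symmetric] compactin_euclidean_iff[symmetric]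
    by (subst compactin_PiE) auto
  moreover have "closed {y. n y = 1}"
    by (rule closed_Collect_eq[OF cont_n continuous_on_const])
  ultimately have "compact K" unfolding K_def by (rule compact_Int_closed)
  have n_pos: "n y > 0 \<longleftrightarrow> (\<exists>v\<in>V. y v \<noteq> 0)" for y
  proof -
    have "n y = 0 \<longleftrightarrow> (\<forall>v\<in>V. y v = 0)"
      unfolding n_def using fin by (subst sum_nonneg_eq_0_iff) auto
    moreover have "n y \<ge> 0" unfolding n_def by (simp add: sum_nonneg)
    ultimately show ?thesis by force
  qed
  have K_normal: "(\<lambda>v. if v \<in> V then y v / sqrt (n y) else 0) \<in> K" if "n y > 0" for y
  proof -
    have "n (\<lambda>v. if v \<in> V then y v / sqrt (n y) else 0) = (\<Sum>v\<in>V. (y v)\<^sup>2 / n y)"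
      unfolding n_def by (intro sum.cong refl) (simp add: power_divide sum_nonneg)
    also have "\<dots> = 1" using that by (simp add: sum_divide_distrib[symmetric] n_def[symmetric])
    finally have 1: "n (\<lambda>v. if v \<in> V then y v / sqrt (n y) else 0) = 1" .
    have "y v / sqrt (n y) \<in> {-1..1}" if v: "v \<in> V" for v
    proof -
      have "(y v)\<^sup>2 \<le> n y" unfolding n_def using fin v by (intro member_le_sum) auto
      then have "\<bar>y v\<bar> \<le> sqrt (n y)" by (metis real_sqrt_abs real_sqrt_le_iff)
      then have "\<bar>y v / sqrt (n y)\<bar> \<le> 1" using \<open>n y > 0\<close> by (simp add: divide_le_eq)
      then show ?thesis unfolding abs_le_iff atLeastAtMost_iff by linarith
    qed
    then show ?thesis using 1 by (simp add: K_def PiE_iff)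
  qed
  have "n (\<lambda>v. 1) > 0" using n_pos[of "\<lambda>v. 1"] ne by auto
  then have "K \<noteq> {}" using K_normal by blast
  then obtain x0 where x0: "x0 \<in> K" "\<And>y. y \<in> K \<Longrightarrow> B y y \<le> B x0 x0"
    using continuous_attains_sup[OF \<open>compact K\<close> _ cont_B] by blast
  define k where "k = B x0 x0"
  have le_k: "B y y \<le> k * n y" for y
  proof (cases "n y > 0")
    case False
    then have "\<forall>v\<in>V. y v = 0" using n_pos by blast
    then show ?thesis by (simp add: B_def n_def)
  next
    case True
    let ?y = "\<lambda>v. if v \<in> V then y v / sqrt (n y) else 0"
    have "B ?y ?y = (\<Sum>v\<in>V. y v * (\<Sum>w\<in>V. A v w * y w) / n y)"
      unfolding B_def
    proof (intro sum.cong refl)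
      fix v assume v: "v \<in> V"
      have "(\<Sum>w\<in>V. A v w * ?y w) = (\<Sum>w\<in>V. A v w * y w) / sqrt (n y)"
        unfolding sum_divide_distrib by (intro sum.cong) auto
      then show "?y v * (\<Sum>w\<in>V. A v w * ?y w) = y v * (\<Sum>w\<in>V. A v w * y w) / n y"
        using v True by simp
    qed
    then have "B ?y ?y = B y y / n y" by (simp add: B_def sum_divide_distrib)
    then show ?thesis using x0(2)[OF K_normal[OF True]] True by (simp add: k_def divide_le_eq)
  qed
  define x where "x v = \<bar>x0 v\<bar>" for v
  have nx: "n x = 1" using x0(1) by (simp add: K_def n_def x_def)
  have "B x0 x0 \<le> B x x"
    unfolding B_def sum_distrib_left
  proof (intro sum_mono)
    fix v w
    have "x0 v * x0 w \<le> x v * x w" unfolding x_def by (metis abs_ge_self abs_mult)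
    then show "x0 v * (A v w * x0 w) \<le> x v * (A v w * x w)"
      using mult_left_mono[OF _ nonneg[of v w], of "x0 v * x0 w" "x v * x w"]
      by (simp add: mult.left_commute)
  qed
  then have Bx: "B x x = k" using le_k[of x] nx by (simp add: k_def)
  have B_comm: "B y z = B z y" for y z
  proof -
    have "B y z = (\<Sum>v\<in>V. \<Sum>w\<in>V. z v * A v w * y w)"
      by (simp add: B_def sum_distrib_left mult.assoc)
    also have "\<dots> = (\<Sum>w\<in>V. \<Sum>v\<in>V. z v * A v w * y w)" by (rule sum.swap)
    also have "\<dots> = B z y"
      unfolding B_def sum_distrib_left using sym by (intro sum.cong refl) (simp add: mult_ac)
    finally show ?thesis .
  qed
  \<comment> \<open>The residual of the eigenvector equation. Moving from \<open>x\<close> to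
    \<open>x + t * z\<close> turns \<open>le_k\<close> into a quadratic inequality in
    \<open>t\<close> whose linear coefficient is \<open>2 * n z\<close>, which forces
    \<open>z\<close> to vanish on \<open>V\<close>.\<close>
  define z where "z v = k * x v - (\<Sum>w\<in>V. A v w * x w)" for v
  have "0 \<le> 2 * t * n z + t\<^sup>2 * (k * n z - B z z)" for t
  proof -
    define y where "y v = x v + t * z v" for v
    have A_y: "(\<Sum>w\<in>V. A v w * y w) = (\<Sum>w\<in>V. A v w * x w) + t * (\<Sum>w\<in>V. A v w * z w)" for v
      by (simp add: y_def distrib_left sum.distrib sum_distrib_left mult.left_commute)
    have "B y y = B x x + t * B x z + t * B z x + t\<^sup>2 * B z z"
      unfolding B_def A_y
      by (simp add: y_def algebra_simps sum.distrib sum_distrib_left power2_eq_square)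
    then have 1: "B y y = k + 2 * t * B x z + t\<^sup>2 * B z z" using B_comm[of x z] Bx by simp
    have "n y = n x + 2 * t * (\<Sum>v\<in>V. x v * z v) + t\<^sup>2 * n z"
      unfolding n_def y_def
      by (simp add: algebra_simps sum.distrib sum_distrib_left power2_eq_square)
    then have "k * n y - B y y = 2 * t * (k * (\<Sum>v\<in>V. x v * z v) - B x z) + t\<^sup>2 * (k * n z - B z z)"
      using 1 nx by (simp add: algebra_simps)
    also have "k * (\<Sum>v\<in>V. x v * z v) - B x z = n z"
      unfolding B_def n_def sum_distrib_left[of k] sum_subtractf[symmetric]
      by (intro sum.cong refl) (simp add: z_def power2_eq_square algebra_simps)
    finally show ?thesis using le_k[of y] by simp
  qed
  then have "n z = 0" by (rule quadratic_nonneg_linear_coeff)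
  then have z0: "z v = 0" if "v \<in> V" for v using n_pos[of z] that by fastforce
  show ?thesis
  proof (intro exI[of _ k] exI[of _ x] conjI allI impI)
    show "0 \<le> x v" for v by (simp add: x_def)
    show "\<exists>v\<in>V. x v \<noteq> 0" using n_pos[of x] nx by simp
    show "\<forall>v\<in>V. (\<Sum>w\<in>V. A v w * x w) = k * x v" using z0 by (simp add: z_def)
  next
    fix l y assume y: "\<exists>v\<in>V. y v \<noteq> 0" "\<forall>v\<in>V. (\<Sum>w\<in>V. A v w * y w) = l * y v"
    have "B y y = l * n y"
      unfolding B_def n_def sum_distrib_left[of l]
      using y(2) by (intro sum.cong refl) (simp add: power2_eq_square)
    then have "l * n y \<le> k * n y" using le_k[of y] by simp
    then show "l \<le> k" using n_pos[of y] y(1) by simp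
  qed
qed

text \<open>The matrix-free side of \<open>eigenvalue_adjacency_matrix_iff\<close>, which removes
  the choice of an enumeration from all later arguments.\<close>

definition graph_eigenvalue :: "'a sgraph \<Rightarrow> real \<Rightarrow> bool" where
  "graph_eigenvalue G k \<longleftrightarrow> (\<exists>x. (\<exists>v\<in>vertices G. x v \<noteq> 0) \<and>
     (\<forall>v\<in>vertices G. (\<Sum>u | u \<in> vertices G \<and> {v, u} \<in> edges G. x u) = k * x v))"

lemma graph_spectral_radius_eq_Max:
  assumes "finite (vertices G)"
  shows "graph_spectral_radius G = Max (Collect (graph_eigenvalue G))"
    and "finite (Collect (graph_eigenvalue G))"
proof -
  define vs where "vs = (SOME vs. distinct vs \<and> set vs = vertices G)"
  have vs: "distinct vs \<and> set vs = vertices G"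
    unfolding vs_def using finite_distinct_list[OF assms] by (metis (mono_tags, lifting) someI_ex)
  then have "eigenvalue (adjacency_matrix vs G) k \<longleftrightarrow> graph_eigenvalue G k" for k
    unfolding graph_eigenvalue_def by (intro eigenvalue_adjacency_matrix_iff) auto
  then have eq: "Collect (eigenvalue (adjacency_matrix vs G)) = Collect (graph_eigenvalue G)"
    by (intro arg_cong[of _ _ Collect] ext)
  show "graph_spectral_radius G = Max (Collect (graph_eigenvalue G))"
    unfolding graph_spectral_radius_def vs_def[symmetric] using eq by simp
  have "adjacency_matrix vs G \<in> carrier_mat (length vs) (length vs)"
    by (simp add: adjacency_matrix_def)
  then show "finite (Collect (graph_eigenvalue G))"
    using card_finite_spectrum(1) eq by (metis spectrum_def)
qed

lemma graph_eigenvalue_le: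
  assumes "finite (vertices G)" "graph_eigenvalue G k"
  shows "k \<le> graph_spectral_radius G"
  using graph_spectral_radius_eq_Max[OF assms(1)] assms(2) by simp

lemma perron_vector:
  assumes fin: "finite (vertices G)" and ne: "vertices G \<noteq> {}"
  obtains x where "\<And>v. 0 \<le> x v" "\<exists>v\<in>vertices G. x v \<noteq> 0"
    "\<And>v. v \<in> vertices G \<Longrightarrow>
      (\<Sum>u | u \<in> vertices G \<and> {v, u} \<in> edges G. x u) = graph_spectral_radius G * x v"
proof -
  let ?A = "\<lambda>v w. if {v, w} \<in> edges G then 1 else 0 :: real"
  have sum_A: "(\<Sum>w\<in>vertices G. ?A v w * x w) = (\<Sum>u | u \<in> vertices G \<and> {v, u} \<in> edges G. x u)"
    for v x
    using fin by (simp add: sum.inter_filter) (intro sum.cong, auto)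
  have sym: "?A v w = ?A w v" and nonneg: "0 \<le> ?A v w" for v w
    by (simp_all add: insert_commute)
  obtain k x where x: "\<forall>v. 0 \<le> x v" "\<exists>v\<in>vertices G. x v \<noteq> 0"
    "\<forall>v\<in>vertices G. (\<Sum>w\<in>vertices G. ?A v w * x w) = k * x v"
    and max: "\<forall>l y. (\<exists>v\<in>vertices G. y v \<noteq> 0) \<longrightarrow>
      (\<forall>v\<in>vertices G. (\<Sum>w\<in>vertices G. ?A v w * y w) = l * y v) \<longrightarrow> l \<le> k"
    using max_eigenvalue_symmetric_nonneg[where A = ?A, OF fin ne sym nonneg] by (elim exE conjE)
  have "graph_eigenvalue G k" using x unfolding graph_eigenvalue_def sum_A by blast
  moreover have "l \<le> k" if "graph_eigenvalue G l" for l
    using that max unfolding graph_eigenvalue_def sum_A by blast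
  ultimately have "graph_spectral_radius G = k"
    using graph_spectral_radius_eq_Max[OF fin] by (auto intro!: Max_eqI)
  then show ?thesis using that x unfolding sum_A by blast
qed

lemma graph_isomorphic_eigenvalue:
  assumes iso: "graph_isomorphic G H" and k: "graph_eigenvalue H k"
  shows "graph_eigenvalue G k"
proof -
  obtain f where bij: "bij_betw f (vertices G) (vertices H)"
    and f: "\<And>u v. u \<in> vertices G \<Longrightarrow> v \<in> vertices G \<Longrightarrow> {u, v} \<in> edges G \<longleftrightarrow> {f u, f v} \<in> edges H"
    using iso unfolding graph_isomorphic_def by blast
  obtain x where x: "\<exists>v\<in>vertices H. x v \<noteq> 0"
    "\<And>v. v \<in> vertices H \<Longrightarrow> (\<Sum>u | u \<in> vertices H \<and> {v, u} \<in> edges H. x u) = k * x v"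
    using k unfolding graph_eigenvalue_def by blast
  have "(\<Sum>u | u \<in> vertices G \<and> {v, u} \<in> edges G. x (f u)) = k * x (f v)" if v: "v \<in> vertices G" for v
  proof -
    let ?S = "{u. u \<in> vertices G \<and> {v, u} \<in> edges G}"
    have inj: "inj_on f (vertices G)" and im: "f ` vertices G = vertices H"
      using bij by (auto simp: bij_betw_def)
    have "f ` ?S = {u. u \<in> vertices H \<and> {f v, u} \<in> edges H}"
    proof (intro equalityI subsetI)
      fix u assume "u \<in> f ` ?S"
      then show "u \<in> {u. u \<in> vertices H \<and> {f v, u} \<in> edges H}" using im f[OF v] by auto
    next
      fix u assume u: "u \<in> {u. u \<in> vertices H \<and> {f v, u} \<in> edges H}"
      then obtain a where "a \<in> vertices G" "u = f a" using im by auto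
      then show "u \<in> f ` ?S" using u f[OF v] by auto
    qed
    moreover have "sum x (f ` ?S) = (\<Sum>u\<in>?S. x (f u))"
      using inj by (subst sum.reindex) (auto simp: inj_on_def)
    moreover have "f v \<in> vertices H" using im v by auto
    ultimately show ?thesis using x(2)[of "f v"] by simp
  qed
  moreover have "\<exists>v\<in>vertices G. x (f v) \<noteq> 0"
  proof -
    obtain u where u: "u \<in> vertices H" "x u \<noteq> 0" using x(1) by blast
    then obtain a where "a \<in> vertices G" "u = f a" using bij by (auto simp: bij_betw_def)
    then show ?thesis using u by blast
  qed
  ultimately show ?thesis unfolding graph_eigenvalue_def by (intro exI[of _ "x \<circ> f"]) simp
qed

lemma graph_isomorphic_sym: "graph_isomorphic G H \<Longrightarrow> graph_isomorphic H G"
  unfolding graph_isomorphic_def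
proof (elim exE conjE)
  fix f assume bij: "bij_betw f (vertices G) (vertices H)"
    and f: "\<forall>u\<in>vertices G. \<forall>v\<in>vertices G. ({u, v} \<in> edges G) = ({f u, f v} \<in> edges H)"
  let ?g = "the_inv_into (vertices G) f"
  have g: "?g u \<in> vertices G" "f (?g u) = u" if "u \<in> vertices H" for u
    using bij that bij_betw_the_inv_into[OF bij]
    by (auto simp: bij_betw_def f_the_inv_into_f)
  show "\<exists>f. bij_betw f (vertices H) (vertices G) \<and>
      (\<forall>u\<in>vertices H. \<forall>v\<in>vertices H. ({u, v} \<in> edges H) = ({f u, f v} \<in> edges G))"
    using bij_betw_the_inv_into[OF bij] f g by (intro exI[of _ ?g]) auto
qed

lemma graph_isomorphic_spectral_radius:
  assumes iso: "graph_isomorphic G H" and "finite (vertices G)" "finite (vertices H)"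
  shows "graph_spectral_radius G = graph_spectral_radius H"
proof -
  have "graph_eigenvalue G = graph_eigenvalue H"
    using graph_isomorphic_eigenvalue[OF iso]
      graph_isomorphic_eigenvalue[OF graph_isomorphic_sym[OF iso]] by blast
  then show ?thesis using graph_spectral_radius_eq_Max(1) assms(2,3) by metis
qed

lemma handshake:
  assumes G: "fin_simple_graph G"
  shows "(\<Sum>v\<in>vertices G. card {w \<in> vertices G. {v, w} \<in> edges G}) = 2 * card (edges G)"
proof -
  let ?V = "vertices G" and ?E = "edges G"
  have finV: "finite ?V" and E: "\<And>e. e \<in> ?E \<Longrightarrow> e \<subseteq> ?V \<and> card e = 2"
    using G by (auto simp: fin_simple_graph_def)
  have finE: "finite ?E" using E finV by (intro finite_subset[of ?E "Pow ?V"]) auto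
  have "card {w \<in> ?V. {v, w} \<in> ?E} = card {e \<in> ?E. v \<in> e}" for v
  proof (rule bij_betw_same_card[of "\<lambda>w. {v, w}"])
    have "inj_on (\<lambda>w. {v, w}) {w \<in> ?V. {v, w} \<in> ?E}"
      by (auto simp: inj_on_def doubleton_eq_iff)
    moreover have "e \<in> (\<lambda>w. {v, w}) ` {w \<in> ?V. {v, w} \<in> ?E}" if e: "e \<in> ?E" "v \<in> e" for e
    proof -
      obtain w where "e = {v, w}" using E[OF e(1)] e(2) by (auto simp: card_2_iff)
      then show ?thesis using E[OF e(1)] e by auto
    qed
    ultimately show "bij_betw (\<lambda>w. {v, w}) {w \<in> ?V. {v, w} \<in> ?E} {e \<in> ?E. v \<in> e}"
      by (auto simp: bij_betw_def)
  qed
  then have "(\<Sum>v\<in>?V. card {w \<in> ?V. {v, w} \<in> ?E}) = (\<Sum>v\<in>?V. \<Sum>e\<in>?E. if v \<in> e then 1 else 0)"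
    using finE by (simp add: sum.inter_filter[symmetric])
  also have "\<dots> = (\<Sum>e\<in>?E. \<Sum>v\<in>?V. if v \<in> e then 1 else 0)" by (rule sum.swap)
  also have "\<dots> = (\<Sum>e\<in>?E. 2)"
  proof (rule sum.cong[OF refl])
    fix e assume e: "e \<in> ?E"
    have "(\<Sum>v\<in>?V. if v \<in> e then 1 else 0) = card {v \<in> ?V. v \<in> e}"
      using finV by (simp add: sum.inter_filter[symmetric])
    also have "{v \<in> ?V. v \<in> e} = e" using E[OF e] by auto
    finally show "(\<Sum>v\<in>?V. if v \<in> e then 1 else 0) = (2::nat)" using E[OF e] by simp
  qed
  finally show ?thesis by simp
qed

section \<open>The domino and the extremal graph\<close>

lemma path_edges_simps:
  "path_edges [v] = {}"
  "path_edges (v # w # vs) = insert {v, w} (path_edges (w # vs))"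
proof -
  show "path_edges [v] = {}" by (simp add: path_edges_def)
  show "path_edges (v # w # vs) = insert {v, w} (path_edges (w # vs))"
  proof (intro equalityI subsetI)
    fix e assume "e \<in> path_edges (v # w # vs)"
    then obtain i where "e = {(v # w # vs) ! i, (v # w # vs) ! Suc i}" "Suc i < length (v # w # vs)"
      unfolding path_edges_def by blast
    then show "e \<in> insert {v, w} (path_edges (w # vs))"
      unfolding path_edges_def by (cases i) auto
  next
    fix e assume "e \<in> insert {v, w} (path_edges (w # vs))"
    then consider "e = {v, w}" | i where "e = {(w # vs) ! i, (w # vs) ! Suc i}" "Suc i < length (w # vs)"
      unfolding path_edges_def by blast
    then show "e \<in> path_edges (v # w # vs)"
    proof cases
      case 1
      then show ?thesis unfolding path_edges_def by (intro CollectI exI[of _ 0]) simp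
    next
      case (2 i)
      then show ?thesis unfolding path_edges_def by (intro CollectI exI[of _ "Suc i"]) simp
    qed
  qed
qed

lemma theta1_3_3:
  "vertices (theta1 3 3) = {0, 1, 2, 3, 4, 5}"
  "edges (theta1 3 3) = {{0, 3}, {0, 1}, {1, 2}, {2, 3}, {0, 5}, {5, 4}, {4, 3}}"
proof -
  show "vertices (theta1 3 3) = {0, 1, 2, 3, 4, 5}" by (auto simp: theta1_def)
  have "[0..<Suc 3] = [0, 1, 2, 3]" "[3..<3 + 3] = [3, 4, 5::nat]" by (simp_all add: upt_rec)
  then show "edges (theta1 3 3) = {{0, 3}, {0, 1}, {1, 2}, {2, 3}, {0, 5}, {5, 4}, {4, 3}}"
    unfolding theta1_def by (simp add: path_edges_simps insert_commute)
qed

lemma contains_theta1_3_3: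
  assumes G: "fin_simple_graph G" and dist: "distinct [a, b, c, d, e, f]"
    and sub: "{{a, b}, {b, c}, {d, e}, {e, f}, {a, d}, {b, e}, {c, f}} \<subseteq> edges G"
  shows "contains_graph G (theta1 3 3)"
proof -
  let ?T = "theta1 3 3"
  \<comment> \<open>The shared edge \<open>{b, e}\<close> takes the role of the branch edge
    \<open>{0, 3}\<close>, and \<open>b a d e f c\<close> runs around the outer 6-cycle.\<close>
  define g where "g i = [b, a, d, e, f, c] ! i" for i :: nat
  have g: "g 0 = b" "g (Suc 0) = a" "g 2 = d" "g 3 = e" "g 4 = f" "g 5 = c"
    by (simp_all add: g_def)
  define H where "H = \<lparr>vertices = g ` vertices ?T, edges = (`) g ` edges ?T\<rparr>"
  have VH: "vertices H = {b, a, d, e, f, c}"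
    and EH: "edges H = {{b, e}, {b, a}, {a, d}, {d, e}, {b, c}, {c, f}, {f, e}}"
    by (simp_all add: H_def theta1_3_3 g)
  have inj: "inj_on g (vertices ?T)"
    unfolding theta1_3_3 using dist by (intro inj_onI) (elim insertE emptyE; simp add: g)
  have "{i, j} \<in> edges ?T \<longleftrightarrow> {g i, g j} \<in> edges H"
    if "i \<in> vertices ?T" "j \<in> vertices ?T" for i j
  proof -
    have "inj_on ((`) g) (Pow (vertices ?T))" using inj by (rule inj_on_image_Pow)
    moreover have "edges ?T \<subseteq> Pow (vertices ?T)" unfolding theta1_3_3 by simp
    ultimately have "g ` {i, j} \<in> (`) g ` edges ?T \<longleftrightarrow> {i, j} \<in> edges ?T"
      using that by (intro inj_on_image_mem_iff) auto
    then show ?thesis by (simp add: H_def)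
  qed
  moreover have "bij_betw g (vertices ?T) (vertices H)"
    unfolding H_def bij_betw_def using inj by simp
  ultimately have "graph_isomorphic ?T H"
    unfolding graph_isomorphic_def by (intro exI[of _ g] conjI ballI)
  then have "graph_isomorphic H ?T" by (rule graph_isomorphic_sym)
  moreover have "subgraph_of H G"
  proof -
    have EG: "edges H \<subseteq> edges G" using sub by (simp add: EH insert_commute)
    moreover have VG: "e' \<subseteq> vertices G" if "e' \<in> edges G" for e'
      using G that by (simp add: fin_simple_graph_def)
    then have "vertices H \<subseteq> vertices G" using VG[of "{a, b}"] VG[of "{d, e}"] VG[of "{c, f}"] sub
      by (simp add: VH)
    moreover have "fin_simple_graph H"
      using EG G unfolding fin_simple_graph_def by (auto simp: VH EH)
    ultimately show ?thesis by (simp add: subgraph_of_def)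
  qed
  ultimately show ?thesis unfolding contains_graph_def by blast
qed

section \<open>Adjacency and an eigenvalue of the extremal graph\<close>

lemma S_minus_edges:
  "{Inl i, Inl j} \<in> edges (S_minus_graph n 2) \<longleftrightarrow> i < 2 \<and> j < 2 \<and> i \<noteq> j"
  "{Inl i, Inr k} \<in> edges (S_minus_graph n 2) \<longleftrightarrow> i < 2 \<and> k < n - 2 \<and> \<not> (i = 0 \<and> k = 0)"
  "{Inr k, Inl i} \<in> edges (S_minus_graph n 2) \<longleftrightarrow> i < 2 \<and> k < n - 2 \<and> \<not> (i = 0 \<and> k = 0)"
  "{Inr k, Inr l} \<notin> edges (S_minus_graph n 2)"
  "{v} \<notin> edges (S_minus_graph n 2)"
proof -
  let ?K = "{{i, j} | i j. i < 2 \<and> j < 2 \<and> i \<noteq> j} :: nat set set"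
  let ?C = "{{Inl i, Inr k} | i k. i < 2 \<and> k < n - 2} :: (nat + nat) set set"
  have E: "edges (S_minus_graph n 2) = (`) Inl ` ?K \<union> ?C - {{Inl 0, Inr 0}}"
    by (simp add: S_minus_graph_def S_graph_def graph_join_def complete_sgraph_def edgeless_sgraph_def)
  have inj: "inj ((`) (Inl :: nat \<Rightarrow> nat + nat))" by (simp add: inj_on_def inj_image_eq_iff)
  have "Inl ` {i, j} \<in> (`) (Inl :: nat \<Rightarrow> nat + nat) ` ?K \<longleftrightarrow> {i, j} \<in> ?K" for i j
    using inj by (rule inj_image_mem_iff)
  moreover have "{i, j} \<in> ?K \<longleftrightarrow> i < 2 \<and> j < 2 \<and> i \<noteq> j" for i j
    by (auto simp: doubleton_eq_iff)
  moreover have "{Inl i, Inl j} \<notin> ?C" for i j by (simp add: doubleton_eq_iff)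
  ultimately show ll: "{Inl i, Inl j} \<in> edges (S_minus_graph n 2) \<longleftrightarrow> i < 2 \<and> j < 2 \<and> i \<noteq> j" for i j
    unfolding E by (simp add: doubleton_eq_iff)
  have no: "{v, Inr k} \<notin> (`) Inl ` ?K" for v :: "nat + nat" and k
  proof
    assume "{v, Inr k} \<in> (`) Inl ` ?K"
    then obtain e where "{v, Inr k} = Inl ` e" by blast
    then have "Inr k \<in> Inl ` e" by blast
    then show False by blast
  qed
  have C: "{Inl i, Inr k} \<in> ?C \<longleftrightarrow> i < 2 \<and> k < n - 2" by (simp add: doubleton_eq_iff)
  show *: "{Inl i, Inr k} \<in> edges (S_minus_graph n 2) \<longleftrightarrow> i < 2 \<and> k < n - 2 \<and> \<not> (i = 0 \<and> k = 0)"
    unfolding E Diff_iff Un_iff C using no by (simp add: doubleton_eq_iff)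
  show "{Inr k, Inl i} \<in> edges (S_minus_graph n 2) \<longleftrightarrow> i < 2 \<and> k < n - 2 \<and> \<not> (i = 0 \<and> k = 0)"
    using * by (simp only: insert_commute)
  have "{Inr k, Inr l} \<notin> ?C" for k l by (simp add: doubleton_eq_iff)
  then show rr: "{Inr k, Inr l} \<notin> edges (S_minus_graph n 2)" for k l
    unfolding E Diff_iff Un_iff using no by blast
  \<comment> \<open>\<open>graph_isomorphic\<close> also compares pairs with equal members; such a
    singleton is the degenerate pair \<open>{v, v}\<close>.\<close>
  show "{v} \<notin> edges (S_minus_graph n 2)"
    using ll rr by (cases v) (metis insert_absorb2)+
qed

lemma S_minus_vertices:
  "vertices (S_minus_graph n 2) = {Inl 0, Inl 1} \<union> Inr ` {..<n - 2}"
  by (auto simp: S_minus_graph_def S_graph_def graph_join_def complete_sgraph_def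
      edgeless_sgraph_def less_2_cases_iff)

text \<open>The quartic is the characteristic equation of the equitable partition of
  \<open>S_minus_graph n 2\<close>.\<close>

lemma S_minus_eigenvalue:
  fixes y :: real and t :: nat
  assumes t: "t = n - 2" "1 \<le> t" and y: "0 < y"
    and root: "y ^ 4 - 2 * real t * y\<^sup>2 - (2 * real t - 2) * y + (real t - 1) = 0"
  shows "graph_eigenvalue (S_minus_graph n 2) y"
proof -
  let ?G = "S_minus_graph n 2"
  \<comment> \<open>Here \<open>s\<close> counts the independent vertices joined to both centres,
    \<open>b\<close> is the entry at the centre \<open>Inl 0\<close> that lost an edge and
    \<open>a\<close> the entry at \<open>Inl 1\<close>. This choice satisfies the equation at
    \<open>Inl 0\<close> identically; the one at \<open>Inl 1\<close> becomes the quartic.\<close>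
  define s a b where "s = real t - 1" and "a = y\<^sup>2 - s" and "b = y + s"
  define x :: "nat + nat \<Rightarrow> real" where
    "x v = (case v of Inl i \<Rightarrow> if i = 0 then b else a | Inr k \<Rightarrow> if k = 0 then a / y else (a + b) / y)" for v
  have "0 \<le> s" using t by (simp add: s_def)
  then have "b > 0" using y by (simp add: b_def)
  have e0: "a + s * ((a + b) / y) = y * b"
    using y by (simp add: a_def b_def field_simps power2_eq_square)
  have "(y\<^sup>2 - s - 1) * a = (y + s) * b"
    using root by (simp add: a_def b_def s_def algebra_simps power2_eq_square power4_eq_xxxx)
  then have e1: "b + (a / y + s * ((a + b) / y)) = y * a"
    using y by (simp add: field_simps power2_eq_square)
  have x_simps: "x (Inl 0) = b" "x (Inl (Suc 0)) = a" "x (Inr 0) = a / y"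
    "\<And>k. k \<noteq> 0 \<Longrightarrow> x (Inr k) = (a + b) / y"
    by (simp_all add: x_def)
  have nb: "{u. u \<in> vertices ?G \<and> {v, u} \<in> edges ?G} =
      (case v of Inl i \<Rightarrow> if i = 0 then insert (Inl 1) (Inr ` {1..<t}) else insert (Inl 0) (Inr ` {..<t})
        | Inr k \<Rightarrow> if k = 0 then {Inl 1} else {Inl 0, Inl 1})" if "v \<in> vertices ?G" for v
    using that unfolding S_minus_vertices t(1)[symmetric] by (auto simp: S_minus_edges t(1)[symmetric] split: if_splits)
  have sum_leaves: "sum x (Inr ` {1..<t}) = s * ((a + b) / y)"
    using t by (subst sum.reindex) (auto simp: x_def s_def of_nat_diff)
  have "{..<t} = insert 0 {1..<t}" using t(2) by auto
  then have "Inr ` {..<t} = insert (Inr 0 :: nat + nat) (Inr ` {1..<t})" by simp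
  moreover have "sum x (insert (Inr 0) (Inr ` {1..<t})) = a / y + s * ((a + b) / y)"
    using sum_leaves by (subst sum.insert) (auto simp: x_def)
  ultimately have sum_all: "sum x (Inr ` {..<t}) = a / y + s * ((a + b) / y)" by simp
  have "(\<Sum>u | u \<in> vertices ?G \<and> {v, u} \<in> edges ?G. x u) = y * x v" if v: "v \<in> vertices ?G" for v
  proof -
    from v consider "v = Inl 0" | "v = Inl 1" | "v = Inr 0" | k where "v = Inr k" "k \<noteq> 0"
      unfolding S_minus_vertices t(1)[symmetric] by auto
    then show ?thesis
    proof cases
      case 1
      have "sum x (insert (Inl 1) (Inr ` {1..<t})) = a + s * ((a + b) / y)"
        using sum_leaves by (subst sum.insert) (auto simp: x_def)
      then show ?thesis using e0 1 unfolding nb[OF v] by (simp add: x_simps)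
    next
      case 2
      have "sum x (insert (Inl 0) (Inr ` {..<t})) = b + (a / y + s * ((a + b) / y))"
        using sum_all by (subst sum.insert) (auto simp: x_def)
      then show ?thesis using e1 2 unfolding nb[OF v] by (simp add: x_simps)
    next
      case 3
      then show ?thesis using y unfolding nb[OF v] by (simp add: x_simps)
    next
      case 4
      then show ?thesis using y unfolding nb[OF v] by (simp add: x_simps)
    qed
  qed
  moreover have "x (Inl 0) \<noteq> 0" "Inl 0 \<in> vertices ?G"
    using \<open>b > 0\<close> by (simp_all add: x_def S_minus_vertices)
  ultimately show ?thesis unfolding graph_eigenvalue_def by blast
qed

text \<open>The quartic equals \<open>- (1 / 4)\<close> at the positive solution \<open>b\<close> of
  \<open>b\<^sup>2 - b = m - 3 / 2\<close>, so it has a root beyond \<open>b\<close>. This is the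
  origin of the \<open>3 / 2\<close> in \<open>few_edges\<close>.\<close>

lemma quartic_root:
  fixes m :: real
  assumes m: "92 \<le> m"
  obtains y where "10 \<le> y" "m - 3 / 2 < y\<^sup>2 - y"
    "y ^ 4 - m * y\<^sup>2 - (m - 2) * y + (m - 2) / 2 = 0"
proof -
  define f where "f y = y ^ 4 - m * y\<^sup>2 - (m - 2) * y + (m - 2) / 2" for y
  define b where "b = (1 + sqrt (4 * m - 5)) / 2"
  have "sqrt (4 * m - 5) ^ 2 = 4 * m - 5" using m by (intro real_sqrt_pow2) auto
  then have b2: "b\<^sup>2 = b + (m - 3 / 2)"
    by (simp add: b_def power2_eq_square field_simps)
  \<comment> \<open>The bound on \<open>m\<close> enters here:
    \<open>4 * m - 5 \<ge> 19\<^sup>2\<close> means \<open>m \<ge> 91.5\<close>, and it yields the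
    bound 10 on the spectral radius.\<close>
  have "19 \<le> sqrt (4 * m - 5)" using m by (intro real_le_rsqrt) auto
  then have b10: "10 \<le> b" by (simp add: b_def)
  have "b ^ 4 = (b + (m - 3 / 2))\<^sup>2" by (simp add: b2[symmetric] flip: power_mult)
  then have "f b = (b + (m - 3 / 2))\<^sup>2 - m * (b + (m - 3 / 2)) - (m - 2) * b + (m - 2) / 2"
    by (simp add: f_def b2)
  also have "\<dots> = b\<^sup>2 - b - (m - 3 / 2) - 1 / 4"
    by (simp add: power2_eq_square field_simps)
  finally have fb: "f b = - (1 / 4)" using b2 by simp
  have "b * 1 \<le> b * (b - 1)" using b10 by (intro mult_left_mono) auto
  then have "b \<le> m" using b2 by (simp add: power2_eq_square algebra_simps)
  have "f m = m\<^sup>2 * (m * (m - 1) - 1) + 2 * m + (m - 2) / 2"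
    by (simp add: f_def algebra_simps power2_eq_square power4_eq_xxxx)
  moreover have "1 * 1 \<le> m * (m - 1)" using m by (intro mult_mono) auto
  ultimately have "0 \<le> f m" using m by simp
  moreover have "continuous_on {b..m} f" unfolding f_def by (intro continuous_intros)
  ultimately obtain y where y: "b \<le> y" "y \<le> m" "f y = 0"
    using IVT'[of f b 0 m] fb \<open>b \<le> m\<close> by auto
  then have "b < y" using fb by (cases "y = b") auto
  then have "b * (b - 1) < y * (y - 1)" using b10 by (intro mult_strict_mono) auto
  then have "m - 3 / 2 < y\<^sup>2 - y" using b2 by (simp add: power2_eq_square algebra_simps)
  then show ?thesis using that[of y] y b10 by (simp add: f_def)
qed

text \<open>The difference of the values at \<open>z\<close> and \<open>y\<close> is
  \<open>(z - y) * ((z + y) * (z\<^sup>2 + y\<^sup>2 - m) - (m - 2))\<close>, and both squares are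
  at least \<open>m\<close>.\<close>

lemma quartic_nonneg:
  fixes m y z :: real
  assumes m: "2 \<le> m" and y: "10 \<le> y" "m - 3 / 2 < y\<^sup>2 - y" and z: "y \<le> z"
    and root: "y ^ 4 - m * y\<^sup>2 - (m - 2) * y + (m - 2) / 2 = 0"
  shows "0 \<le> z ^ 4 - m * z\<^sup>2 - (m - 2) * z + (m - 2) / 2"
proof -
  have "y\<^sup>2 \<le> z\<^sup>2" using y z by (intro power_mono) auto
  then have "m \<le> z\<^sup>2 + y\<^sup>2 - m" using y by linarith
  then have "1 * m \<le> (z + y) * (z\<^sup>2 + y\<^sup>2 - m)" using y z m by (intro mult_mono) auto
  then have "0 \<le> (z - y) * ((z + y) * (z\<^sup>2 + y\<^sup>2 - m) - (m - 2))"
    using z by (intro mult_nonneg_nonneg) auto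
  also have "\<dots> = (z ^ 4 - m * z\<^sup>2 - (m - 2) * z + (m - 2) / 2) - (y ^ 4 - m * y\<^sup>2 - (m - 2) * y + (m - 2) / 2)"
    by (simp add: algebra_simps power2_eq_square power4_eq_xxxx)
  finally show ?thesis using root by simp
qed

text \<open>The vertex \<open>i\<close> misses \<open>c\<close>, so \<open>c\<close> and
  \<open>i\<close> go to the ends \<open>Inl 0\<close> and \<open>Inr 0\<close> of the deleted edge,
  while the dominating vertex \<open>u\<close> goes to \<open>Inl 1\<close>.\<close>

lemma isomorphic_S_minus:
  assumes V: "vertices G = insert u (insert c (insert i L))"
    and dist: "u \<noteq> c" "u \<noteq> i" "c \<noteq> i" "u \<notin> L" "c \<notin> L" "i \<notin> L" and fin: "finite L"
    and u: "\<And>w. w \<in> vertices G \<Longrightarrow> {u, w} \<in> edges G \<longleftrightarrow> w \<noteq> u"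
    and c: "\<And>w. w \<in> vertices G \<Longrightarrow> {c, w} \<in> edges G \<longleftrightarrow> w \<in> insert u L"
    and i: "\<And>w. w \<in> vertices G \<Longrightarrow> {i, w} \<in> edges G \<longleftrightarrow> w = u"
    and L: "\<And>l w. l \<in> L \<Longrightarrow> w \<in> vertices G \<Longrightarrow> {l, w} \<in> edges G \<longleftrightarrow> w = u \<or> w = c"
    and n: "n = card L + 3"
  shows "graph_isomorphic G (S_minus_graph n 2)"
proof -
  obtain h where h: "bij_betw h L {..<card L}"
    using ex_bij_betw_finite_nat[OF fin] by (auto simp: atLeast0LessThan)
  define f where "f v = (if v = u then Inl 1 else if v = c then Inl 0
    else Inr (if v = i then 0 else Suc (h v)) :: nat + nat)" for v
  have n2: "n - 2 = Suc (card L)" using n by simp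
  have f: "f u = Inl 1" "f c = Inl 0" "f i = Inr 0" "\<And>l. l \<in> L \<Longrightarrow> f l = Inr (Suc (h l))"
    using dist by (auto simp: f_def)
  have hL: "h l < card L" if "l \<in> L" for l using h that by (auto simp: bij_betw_def)
  have "inj_on f (vertices G)"
    unfolding V inj_on_def using dist h by (auto simp: f bij_betw_def inj_on_def)
  moreover have "f ` vertices G = vertices (S_minus_graph n 2)"
  proof -
    have "f ` L = Inr ` Suc ` h ` L" by (auto simp: f image_iff)
    also have "h ` L = {..<card L}" using h by (simp add: bij_betw_def)
    finally have "f ` L = Inr ` Suc ` {..<card L}" .
    then show ?thesis unfolding V S_minus_vertices n2 lessThan_Suc_eq_insert_0 by (auto simp: f)
  qed
  ultimately have bij: "bij_betw f (vertices G) (vertices (S_minus_graph n 2))"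
    by (simp add: bij_betw_def)
  have "{v, w} \<in> edges G \<longleftrightarrow> {f v, f w} \<in> edges (S_minus_graph n 2)"
    if v: "v \<in> vertices G" and w: "w \<in> vertices G" for v w
  proof -
    have w': "w = u \<or> w = c \<or> w = i \<or> w \<in> L" using w unfolding V by blast
    from v consider "v = u" | "v = c" | "v = i" | "v \<in> L" unfolding V by blast
    then show ?thesis
    proof cases
      case 1
      then show ?thesis using u[OF w] w' dist hL by (auto simp: f S_minus_edges n2)
    next
      case 2
      then show ?thesis using c[OF w] w' dist hL by (auto simp: f S_minus_edges n2)
    next
      case 3
      then show ?thesis using i[OF w] w' dist hL by (auto simp: f S_minus_edges n2)
    next
      case 4
      then show ?thesis using L[OF 4 w] w' dist hL by (auto simp: f S_minus_edges n2)
    qed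
  qed
  then show ?thesis
    unfolding graph_isomorphic_def using bij by blast
qed

section \<open>Extremality\<close>

text \<open>The root \<open>y\<close> of the quartic is an eigenvalue of the extremal graph, hence
  at most \<rho>; this inequality supplies the numerical assumptions of
  \<open>perron_domino_free\<close>. The structure found there leaves only the number
  \<open>s\<close> of isolated vertices of \<open>G[N]\<close> to determine.\<close>

lemma extremal_isomorphic:
  fixes G :: "'a sgraph" and m :: nat
  assumes m: "92 \<le> m" "even m"
    and G: "fin_simple_graph G" "card (edges G) = m" "no_isolated_vertices G"
    and free: "\<not> contains_graph G (theta1 3 3)"
    and ge: "graph_spectral_radius (S_minus_graph ((m + 4) div 2) 2) \<le> graph_spectral_radius G"
  shows "graph_isomorphic G (S_minus_graph ((m + 4) div 2) 2)"
proof -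
  define V adj \<rho> n where "V = vertices G" and "adj v w \<longleftrightarrow> {v, w} \<in> edges G"
    and "\<rho> = graph_spectral_radius G" and "n = (m + 4) div 2" for v w
  have finV: "finite V" using G(1) by (simp add: V_def fin_simple_graph_def)
  have E: "e \<subseteq> V \<and> card e = 2" if "e \<in> edges G" for e
    using G(1) that by (simp add: V_def fin_simple_graph_def)
  have "edges G \<noteq> {}" using G(2) m by auto
  then have "V \<noteq> {}" using E by force
  have "92 \<le> real m" using m(1) by simp
  then obtain y where y: "10 \<le> y" "real m - 3 / 2 < y\<^sup>2 - y"
    "y ^ 4 - real m * y\<^sup>2 - (real m - 2) * y + (real m - 2) / 2 = 0"
    by (rule quartic_root)
  obtain t where t: "m = 2 * t" using m by (elim evenE)
  have nt: "t = n - 2" "1 \<le> t" using t m by (simp_all add: n_def)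
  have "graph_eigenvalue (S_minus_graph n 2) y"
  proof (rule S_minus_eigenvalue[OF nt])
    show "0 < y" using y(1) by simp
    show "y ^ 4 - 2 * real t * y\<^sup>2 - (2 * real t - 2) * y + (real t - 1) = 0"
      using y(3) by (simp add: t diff_divide_distrib)
  qed
  moreover have "finite (vertices (S_minus_graph n 2))" by (simp add: S_minus_vertices)
  ultimately have "y \<le> \<rho>" using graph_eigenvalue_le ge unfolding \<rho>_def n_def by fastforce
  have "y * (y - 1) \<le> \<rho> * (\<rho> - 1)" using \<open>y \<le> \<rho>\<close> y(1) by (intro mult_mono) auto
  then have \<rho>2: "m - 3 / 2 < \<rho>\<^sup>2 - \<rho>" using y(2) by (simp add: power2_eq_square algebra_simps)
  obtain x0 where x0: "\<And>v. 0 \<le> x0 v" "\<exists>v\<in>V. x0 v \<noteq> 0"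
    "\<And>v. v \<in> V \<Longrightarrow> (\<Sum>u | u \<in> V \<and> {v, u} \<in> edges G. x0 u) = \<rho> * x0 v"
    using perron_vector[of G] finV \<open>V \<noteq> {}\<close> unfolding V_def \<rho>_def by blast
  have "\<exists>u\<in>V. \<forall>v\<in>V. x0 v \<le> x0 u"
    using finV \<open>V \<noteq> {}\<close> obtains_MAX[of V x0] by (metis Max_ge finite_imageI imageI)
  then obtain u where u: "u \<in> V" "\<And>v. v \<in> V \<Longrightarrow> x0 v \<le> x0 u" by blast
  obtain v where "v \<in> V" "x0 v \<noteq> 0" using x0(2) by blast
  then have u_pos: "0 < x0 u" using x0(1)[of v] u(2)[of v] by linarith
  \<comment> \<open>Scaling the Perron vector so that its largest entry, at \<open>u\<close>, is
    1.\<close>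
  define x where "x v = x0 v / x0 u" for v
  interpret domino_free_graph V adj
  proof
    show "finite V" by (rule finV)
    show "v \<in> V" if "adj v w" for v w using E that by (auto simp: adj_def)
    show "adj w v" if "adj v w" for v w using that by (simp add: adj_def insert_commute)
    show "\<not> adj v v" for v using E[of "{v}"] by (auto simp: adj_def)
    show False if "distinct [a, b, c, d, e, f]" "adj a b" "adj b c" "adj d e" "adj e f"
      "adj a d" "adj b e" "adj c f" for a b c d e f
      using contains_theta1_3_3[OF G(1) that(1)] that free by (auto simp: adj_def)
  qed
  interpret perron_domino_free V adj x \<rho> u
  proof
    show "u \<in> V" by (rule u)
    show "x u = 1" using u_pos by (simp add: x_def)
    show "0 \<le> x v" if "v \<in> V" for v using x0 by (simp add: x_def)
    show "x v \<le> 1" if "v \<in> V" for v using u(2)[OF that] u_pos by (simp add: x_def)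
    show "\<rho> * x v = sum x (nbr V v)" if "v \<in> V" for v
      using x0(3)[OF that] by (simp add: x_def nbr_def adj_def sum_divide_distrib[symmetric])
    show "10 \<le> \<rho>" using y \<open>y \<le> \<rho>\<close> by simp
    have "(\<Sum>v\<in>V. deg V v) = real (\<Sum>v\<in>V. card {w \<in> V. {v, w} \<in> edges G})"
      by (simp add: deg_def nbr_def adj_def)
    also have "\<dots> = 2 * m" using handshake[OF G(1)] G(2) by (simp add: V_def)
    finally show "(\<Sum>v\<in>V. deg V v) < 2 * (\<rho>\<^sup>2 - \<rho>) + 3" using \<rho>2 by simp
  qed
  have noiso: "\<exists>w. adj v w" if "v \<in> V" for v
    using G(3) that unfolding no_isolated_vertices_def V_def adj_def by (metis insert_commute)
  obtain c where c: "c \<in> N" and VN: "V = insert u N"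
    and L: "\<And>l. l \<in> nbr N c \<Longrightarrow> nbr V l = {u, c}"
    and I: "\<And>i. i \<in> N - insert c (nbr N c) \<Longrightarrow> nbr V i = {u}"
    using star_structure[OF noiso] by metis
  define r s where "r = card (nbr N c)" and "s = card (N - insert c (nbr N c))"
  note eqs = star_equations[OF c VN L I, folded r_def s_def]
  have "(\<Sum>v\<in>V. deg V v) = real (\<Sum>v\<in>V. card {w \<in> V. {v, w} \<in> edges G})"
    by (simp add: deg_def nbr_def adj_def)
  also have "\<dots> = 2 * m" using handshake[OF G(1)] G(2) by (simp add: V_def)
  finally have "2 * (2 * real r + real s + 1) = 2 * real m" using eqs(1) by simp
  then have mrs: "real m = 2 * real r + real s + 1" by simp
  then have mrs': "m = 2 * r + s + 1" by linarith
  have "s = 1"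
  proof (rule ccontr)
    assume "s \<noteq> 1"
    \<comment> \<open>Parity of \<open>m\<close> excludes \<open>s = 0\<close>, where the sign
      argument below would fail.\<close>
    moreover have "odd s" using mrs' m by simp
    ultimately have s: "real s > 1" by (cases s) auto
    have "0 \<le> \<rho> ^ 4 - m * \<rho>\<^sup>2 - (real m - 2) * \<rho> + (real m - 2) / 2"
      using y m \<open>y \<le> \<rho>\<close> by (intro quartic_nonneg[of m y]) auto
    \<comment> \<open>The quartic of the extremal graph at \<rho>, reduced by the quartic that
      \<rho> satisfies in \<open>G\<close>.\<close>
    also have "\<dots> = - ((real s - 1) * (\<rho> + r - 1 / 2))"
      using eqs(2) unfolding mrs by (simp add: field_simps)
    also have "\<dots> < 0" using s rho_ge by (simp add: mult_pos_pos)
    finally show False by simp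
  qed
  then obtain i where i: "N - insert c (nbr N c) = {i}" by (auto simp: s_def card_1_singleton_iff)
  have "insert c (nbr N c) \<subseteq> N" using c by (simp add: subset_iff)
  then have "insert c (nbr N c) \<union> {i} = N" unfolding i[symmetric] by (rule Diff_partition)
  then have N_eq: "N = insert c (insert i (nbr N c))"
    by (simp only: Un_insert_right Un_empty_right insert_commute)
  show ?thesis
    unfolding n_def[symmetric]
  proof (rule isomorphic_S_minus[of G u c i "nbr N c"])
    show V_eq: "vertices G = insert u (insert c (insert i (nbr N c)))"
      using trans[OF VN arg_cong[OF N_eq, of "insert u"]] unfolding V_def .
    show "u \<noteq> c" using c u_notin by blast
    show "u \<noteq> i" using i u_notin by blast
    show "c \<noteq> i" "i \<notin> nbr N c" using i by blast+
    show "u \<notin> nbr N c" using u_notin by simp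
    show "c \<notin> nbr N c" using adj_irrefl by simp
    show "finite (nbr N c)" by simp
    show "n = card (nbr N c) + 3" using mrs' \<open>s = 1\<close> by (simp add: n_def r_def)
    have adjV: "{v, w} \<in> edges G \<longleftrightarrow> w \<in> nbr V v" if "w \<in> vertices G" for v w
      using that by (simp add: V_def adj_def)
    show "{u, w} \<in> edges G \<longleftrightarrow> w \<noteq> u" if w: "w \<in> vertices G" for w
    proof -
      have "w \<in> insert u N" using w VN unfolding V_def by blast
      then show ?thesis using adj_irrefl N_iff unfolding adj_def by auto
    qed
    show "{c, w} \<in> edges G \<longleftrightarrow> w \<in> insert u (nbr N c)" if w: "w \<in> vertices G" for w
    proof -
      have "w \<in> insert u N" using w VN unfolding V_def by blast
      then show ?thesis using N_adj_u[OF c] by (auto simp: adj_def)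
    qed
    show "{i, w} \<in> edges G \<longleftrightarrow> w = u" if w: "w \<in> vertices G" for w
      using adjV[OF w] I[of i] i by blast
    show "{l, w} \<in> edges G \<longleftrightarrow> w = u \<or> w = c" if l: "l \<in> nbr N c" and w: "w \<in> vertices G" for l w
      using adjV[OF w] L[OF l] by blast
  qed
qed

theorem theorem1p4:
  fixes G :: "'a sgraph" and m :: nat
  assumes "m \<ge> 92" and "even m"
    and "fin_simple_graph G"
    and "card (edges G) = m"
    and "no_isolated_vertices G"
    and "\<not> contains_graph G (theta1 3 3)"
  shows "graph_spectral_radius G \<le> graph_spectral_radius (S_minus_graph ((m + 4) div 2) 2) \<and>
    (graph_spectral_radius G = graph_spectral_radius (S_minus_graph ((m + 4) div 2) 2)
      \<longleftrightarrow> graph_isomorphic G (S_minus_graph ((m + 4) div 2) 2))"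
proof -
  let ?S = "S_minus_graph ((m + 4) div 2) 2"
  have iso_eq: "graph_spectral_radius G = graph_spectral_radius ?S" if "graph_isomorphic G ?S"
    using graph_isomorphic_spectral_radius[OF that] assms(3)
    by (simp add: fin_simple_graph_def S_minus_vertices)
  have "graph_isomorphic G ?S" if "graph_spectral_radius ?S \<le> graph_spectral_radius G"
    using extremal_isomorphic[OF assms that] .
  \<comment> \<open>A larger spectral radius of \<open>G\<close> would also give the isomorphism and
    hence equality, so the upper bound follows too.\<close>
  then show ?thesis using iso_eq by (metis linorder_linear order_refl)
qed

end
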